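(* Let $k$ be a field, $R$ a commutative $k$-algebra and $\Phi$ a ring anti-automorphism on $D_{R|k}$ that fixes $R$ (i.e. $\Phi(f)=f$ for all $f\in R$). Then $\Phi$ is involutive (i.e. $\Phi\circ\Phi=\mathrm{id}$) in the following cases: (1) The algebra $R$ is reduced and essentially of finite type over $k$. (2) The ring $R$ is local, Gorenstein and zero dimensional, $k$ is a coefficient field of $R$, and $\Phi$ is the ring anti-automorphism that corresponds to the compatible right $D_{R|k}$-module structure on $R$ given by pullback via an $R$-module isomorphism $R\cong\operatorname{Hom}_k(R,k)$.
   Context: For a commutative ring $k$ and a commutative $k$-algebra $R$, identify $f\in R$ with the operator $g\mapsto fg$ on $R$, so that $R\subseteq \operatorname{End}_k(R)$. Define inductively $D^0_{R|k}=R$ and $D^n_{R|k}=\{\xi\in\operatorname{End}_k(R): [\xi,f]\in D^{n-1}_{R|k}\text{ for all } f\in R\}$. The ring of $k$-linear differential operators on $R$ is $D_{R|k}=\bigcup_{n\ge 0}D^n_{R|k}\subseteq\operatorname{End}_k(R)$. A ring anti-automorphism of a ring $A$ is a bijective additive map $\Phi:A\to A$ with $\Phi(1)=1$ and $\Phi(xy)=\Phi(y)\Phi(x)$. A right $D_{R|k}$-module structure on an $R$-module is compatible if it extends the already-existing $R$-module structure. Compatible right $D_{R|k}$-module structures on $R$ correspond bijectively to anti-automorphisms $\Phi$ of $D_{R|k}$ fixing $R$, via $\Phi(\xi)(f)=f\cdot\xi$ for $\xi\in D_{R|k}$, $f\in R$. In case (2): $\operatorname{Hom}_k(R,k)$ has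 the right $D_{R|k}$-module structure $(\psi\cdot\xi)(g)=\psi(\xi(g))$, which extends its $R$-module structure given by premultiplication; transporting this structure along an $R$-module isomorphism $\varphi:R\to\operatorname{Hom}_k(R,k)$ gives a compatible right $D_{R|k}$-module structure on $R$, namely $\varphi(f\cdot\xi)=\varphi(f)\circ\xi$. A coefficient field of a local ring $(R,\mathfrak m)$ is a subfield $k\subseteq R$ mapping isomorphically onto $R/\mathfrak m$. *)

theory Defs
  imports "HOL-Algebra.Algebra" "HOL-Library.Extended_Nat"
begin

section \<open>Linear maps\<close>

text \<open>
  Maps are kept extensional (undefined off the carrier), so that equality of operators is
  equality in HOL.
\<close>

definition linear_maps ::
    "('k, 'x) ring_scheme \<Rightarrow> ('k, 'a, 'y) module_scheme \<Rightarrow> ('k, 'b, 'z) module_scheme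
      \<Rightarrow> ('a \<Rightarrow> 'b) set"
  where "linear_maps R M N =
    {h \<in> carrier M \<rightarrow>\<^sub>E carrier N.
       (\<forall>x\<in>carrier M. \<forall>y\<in>carrier M. h (x \<oplus>\<^bsub>M\<^esub> y) = h x \<oplus>\<^bsub>N\<^esub> h y) \<and>
       (\<forall>c\<in>carrier R. \<forall>x\<in>carrier M. h (c \<odot>\<^bsub>M\<^esub> x) = c \<odot>\<^bsub>N\<^esub> h x)}"

definition linear_isos ::
    "('k, 'x) ring_scheme \<Rightarrow> ('k, 'a, 'y) module_scheme \<Rightarrow> ('k, 'b, 'z) module_scheme
      \<Rightarrow> ('a \<Rightarrow> 'b) set"
  where "linear_isos R M N = {h \<in> linear_maps R M N. bij_betw h (carrier M) (carrier N)}"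

text \<open>A ring (possibly carrying another scalar multiplication) as a module over itself.\<close>

definition self_module :: "('a, 'x) ring_scheme \<Rightarrow> ('a, 'a) module"
  where "self_module R =
    \<lparr>carrier = carrier R, monoid.mult = monoid.mult R, one = one R, ring.zero = ring.zero R, ring.add = ring.add R,
     smult = monoid.mult R\<rparr>"

definition End_ring ::
    "('k, 'x) ring_scheme \<Rightarrow> ('k, 'a, 'y) module_scheme \<Rightarrow> ('a \<Rightarrow> 'a) ring"
  where "End_ring k R =
    \<lparr>carrier = linear_maps k R R,
     monoid.mult = (\<lambda>\<xi> \<eta>. compose (carrier R) \<xi> \<eta>),
     one = (\<lambda>g\<in>carrier R. g),
     ring.zero = (\<lambda>g\<in>carrier R. \<zero>\<^bsub>R\<^esub>),
     ring.add = (\<lambda>\<xi> \<eta>. \<lambda>g\<in>carrier R. \<xi> g \<oplus>\<^bsub>R\<^esub> \<eta> g)\<rparr>"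


section \<open>Differential operators\<close>

definition mult_op :: "('a, 'x) ring_scheme \<Rightarrow> 'a \<Rightarrow> 'a \<Rightarrow> 'a"
  where "mult_op R f = (\<lambda>g\<in>carrier R. f \<otimes>\<^bsub>R\<^esub> g)"

text \<open>The commutator \<open>[\<xi>, f] = \<xi> \<circ> f - f \<circ> \<xi>\<close>, with \<open>f\<close> acting by multiplication.\<close>

definition commutator :: "('a, 'x) ring_scheme \<Rightarrow> ('a \<Rightarrow> 'a) \<Rightarrow> 'a \<Rightarrow> 'a \<Rightarrow> 'a"
  where "commutator R \<xi> f =
    (\<lambda>g\<in>carrier R. \<xi> (f \<otimes>\<^bsub>R\<^esub> g) \<ominus>\<^bsub>R\<^esub> f \<otimes>\<^bsub>R\<^esub> \<xi> g)"

primrec diff_ops_upto ::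
    "('k, 'x) ring_scheme \<Rightarrow> ('k, 'a, 'y) module_scheme \<Rightarrow> nat \<Rightarrow> ('a \<Rightarrow> 'a) set"
  where
    "diff_ops_upto k R 0 = mult_op R ` carrier R"
  | "diff_ops_upto k R (Suc n) =
      {\<xi> \<in> linear_maps k R R. \<forall>f\<in>carrier R. commutator R \<xi> f \<in> diff_ops_upto k R n}"

definition diff_ops_ring ::
    "('k, 'x) ring_scheme \<Rightarrow> ('k, 'a, 'y) module_scheme \<Rightarrow> ('a \<Rightarrow> 'a) ring"
  where "diff_ops_ring k R = (End_ring k R)\<lparr>carrier := (\<Union>n. diff_ops_upto k R n)\<rparr>"

definition ring_anti_automorphism :: "('a, 'x) ring_scheme \<Rightarrow> ('a \<Rightarrow> 'a) \<Rightarrow> bool"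
  where "ring_anti_automorphism A \<Phi> \<longleftrightarrow>
    bij_betw \<Phi> (carrier A) (carrier A) \<and>
    (\<forall>x\<in>carrier A. \<forall>y\<in>carrier A. \<Phi> (x \<oplus>\<^bsub>A\<^esub> y) = \<Phi> x \<oplus>\<^bsub>A\<^esub> \<Phi> y) \<and>
    \<Phi> \<one>\<^bsub>A\<^esub> = \<one>\<^bsub>A\<^esub> \<and>
    (\<forall>x\<in>carrier A. \<forall>y\<in>carrier A. \<Phi> (x \<otimes>\<^bsub>A\<^esub> y) = \<Phi> y \<otimes>\<^bsub>A\<^esub> \<Phi> x)"


section \<open>Reduced algebras, algebras essentially of finite type\<close>

definition reduced_ring :: "('a, 'x) ring_scheme \<Rightarrow> bool"
  where "reduced_ring R \<longleftrightarrow>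
    (\<forall>x\<in>carrier R. \<forall>n::nat. x [^]\<^bsub>R\<^esub> n = \<zero>\<^bsub>R\<^esub> \<longrightarrow> x = \<zero>\<^bsub>R\<^esub>)"

definition structure_map :: "('k, 'a, 'x) module_scheme \<Rightarrow> 'k \<Rightarrow> 'a"
  where "structure_map R c = c \<odot>\<^bsub>R\<^esub> \<one>\<^bsub>R\<^esub>"

definition finitely_generated_algebra ::
    "('k, 'x) ring_scheme \<Rightarrow> ('k, 'a, 'y) module_scheme \<Rightarrow> bool"
  where "finitely_generated_algebra k A \<longleftrightarrow>
    algebra k A \<and>
    (\<exists>G. finite G \<and> G \<subseteq> carrier A \<and>
         carrier A = generate_ring A (structure_map A ` carrier k \<union> G))"

text \<open>
  \<open>\<phi> : A \<rightarrow> R\<close> exhibits \<open>R\<close> as the localization \<open>S\<^sup>-\<^sup>1A\<close>: elements of \<open>S\<close> become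
  units, every element of \<open>R\<close> is a fraction \<open>\<phi>(a)\<phi>(s)\<^sup>-\<^sup>1\<close>, and \<open>a/1 = 0\<close> in \<open>R\<close> only if
  some \<open>s \<in> S\<close> kills \<open>a\<close>.
\<close>

definition is_localization ::
    "('a, 'x) ring_scheme \<Rightarrow> 'a set \<Rightarrow> ('b, 'y) ring_scheme \<Rightarrow> ('a \<Rightarrow> 'b) \<Rightarrow> bool"
  where "is_localization A S R \<phi> \<longleftrightarrow>
    submonoid S A \<and>
    \<phi> \<in> ring_hom A R \<and>
    \<phi> ` S \<subseteq> Units R \<and>
    (\<forall>r\<in>carrier R. \<exists>a\<in>carrier A. \<exists>s\<in>S. r = \<phi> a \<otimes>\<^bsub>R\<^esub> inv\<^bsub>R\<^esub> (\<phi> s)) \<and>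
    (\<forall>a\<in>carrier A. \<phi> a = \<zero>\<^bsub>R\<^esub> \<longrightarrow> (\<exists>s\<in>S. s \<otimes>\<^bsub>A\<^esub> a = \<zero>\<^bsub>A\<^esub>))"

text \<open>
  The type argument only says where the carrier of the finitely generated algebra \<open>A\<close> lives.
  The carrier type of \<open>R\<close> is already large enough, since \<open>A\<close> may be replaced by its image
  in \<open>R\<close>; leaving the type arbitrary avoids building this reduction into the definition.
\<close>

definition essentially_of_finite_type ::
    "'b itself \<Rightarrow> ('k, 'x) ring_scheme \<Rightarrow> ('k, 'a, 'y) module_scheme \<Rightarrow> bool"
  where "essentially_of_finite_type _ k R \<longleftrightarrow>
    (\<exists>(A :: ('k, 'b) module) S \<phi>.
       finitely_generated_algebra k A \<and>
       is_localization A S R \<phi> \<and>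
       (\<forall>c\<in>carrier k. \<forall>a\<in>carrier A. \<phi> (c \<odot>\<^bsub>A\<^esub> a) = c \<odot>\<^bsub>R\<^esub> \<phi> a))"


section \<open>Local, zero-dimensional and Gorenstein rings\<close>

definition local_ring :: "('a, 'x) ring_scheme \<Rightarrow> bool"
  where "local_ring R \<longleftrightarrow> cring R \<and> (\<exists>!M. maximalideal M R)"

text \<open>
  Supremum of the lengths \<open>n\<close> of chains \<open>P\<^sub>0 \<subset> \<dots> \<subset> P\<^sub>n\<close> of prime ideals (with value 0 for
  the zero ring).
\<close>

definition krull_dim :: "('a, 'x) ring_scheme \<Rightarrow> enat"
  where "krull_dim R =
    Sup {enat n | n. \<exists>P :: nat \<Rightarrow> 'a set.
           (\<forall>i\<le>n. primeideal (P i) R) \<and> (\<forall>i<n. P i \<subset> P (Suc i))}"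

text \<open>
  Lifting property of injective modules. The test modules \<open>N \<rightarrow> M\<close> have carriers in the type of
  the ring; these include the inclusions of ideals in the ring, so by Baer's criterion nothing is
  lost.
\<close>

definition injective_module :: "('a, 'x) ring_scheme \<Rightarrow> ('a, 'e, 'y) module_scheme \<Rightarrow> bool"
  where "injective_module R E \<longleftrightarrow>
    module R E \<and>
    (\<forall>(N :: ('a, 'a) module) (M :: ('a, 'a) module) \<iota> f.
       module R N \<and> module R M \<and>
       \<iota> \<in> linear_maps R N M \<and> inj_on \<iota> (carrier N) \<and> f \<in> linear_maps R N E \<longrightarrow>
       (\<exists>h\<in>linear_maps R M E. \<forall>x\<in>carrier N. h (\<iota> x) = f x))"

text \<open>
  Existence of an exact sequence \<open>0 \<rightarrow> M \<rightarrow> E\<^sub>0 \<rightarrow> E\<^sub>1 \<rightarrow> \<dots>\<close> of \<open>R\<close>-modules with all \<open>E\<^sub>i\<close>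
  injective and \<open>E\<^sub>i = 0\<close> for \<open>i\<close> large. The type argument says where the carriers of the
  \<open>E\<^sub>i\<close> live; as a hypothesis, it is to be used with an arbitrary type.
\<close>

definition finite_injective_dimension ::
    "'e itself \<Rightarrow> ('a, 'x) ring_scheme \<Rightarrow> ('a, 'm, 'y) module_scheme \<Rightarrow> bool"
  where "finite_injective_dimension _ R M \<longleftrightarrow>
    (\<exists>n (E :: nat \<Rightarrow> ('a, 'e) module) \<epsilon> d.
       (\<forall>i. injective_module R (E i)) \<and>
       (\<forall>i>n. carrier (E i) = {\<zero>\<^bsub>E i\<^esub>}) \<and>
       \<epsilon> \<in> linear_maps R M (E 0) \<and> inj_on \<epsilon> (carrier M) \<and>
       (\<forall>i. d i \<in> linear_maps R (E i) (E (Suc i))) \<and>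
       \<epsilon> ` carrier M = {x \<in> carrier (E 0). d 0 x = \<zero>\<^bsub>E 1\<^esub>} \<and>
       (\<forall>i. d i ` carrier (E i) =
             {x \<in> carrier (E (Suc i)). d (Suc i) x = \<zero>\<^bsub>E (Suc (Suc i))\<^esub>}))"

definition gorenstein_local_ring :: "'e itself \<Rightarrow> ('a, 'x) ring_scheme \<Rightarrow> bool"
  where "gorenstein_local_ring T R \<longleftrightarrow>
    local_ring R \<and> noetherian_ring R \<and> finite_injective_dimension T R (self_module R)"

definition coefficient_field :: "'a set \<Rightarrow> ('a, 'x) ring_scheme \<Rightarrow> bool"
  where "coefficient_field K R \<longleftrightarrow>
    local_ring R \<and> subfield K R \<and>
    (\<forall>M. maximalideal M R \<longrightarrow>
       (\<lambda>x. M +>\<^bsub>R\<^esub> x) \<in> ring_iso (R\<lparr>carrier := K\<rparr>) (R Quot M))"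


section \<open>The dual module and right module structures\<close>

text \<open>
  \<open>Hom\<^sub>k(R, k)\<close> as an \<open>R\<close>-module, with \<open>(f \<psi>)(g) = \<psi>(f g)\<close>. The fields \<open>mult\<close> and
  \<open>one\<close> of the record play no role for modules.
\<close>

definition dual_module ::
    "('k, 'x) ring_scheme \<Rightarrow> ('k, 'a, 'y) module_scheme \<Rightarrow> ('a, 'a \<Rightarrow> 'k) module"
  where "dual_module k R =
    \<lparr>carrier = linear_maps k R (self_module k),
     monoid.mult = undefined, one = undefined,
     ring.zero = (\<lambda>g\<in>carrier R. \<zero>\<^bsub>k\<^esub>),
     ring.add = (\<lambda>\<psi> \<chi>. \<lambda>g\<in>carrier R. \<psi> g \<oplus>\<^bsub>k\<^esub> \<chi> g),
     smult = (\<lambda>f \<psi>. \<lambda>g\<in>carrier R. \<psi> (f \<otimes>\<^bsub>R\<^esub> g))\<rparr>"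

text \<open>The right action \<open>\<psi> \<cdot> \<xi> = \<psi> \<circ> \<xi>\<close> of differential operators on \<open>Hom\<^sub>k(R, k)\<close>.\<close>

definition dual_action ::
    "('a, 'x) ring_scheme \<Rightarrow> ('a \<Rightarrow> 'k) \<Rightarrow> ('a \<Rightarrow> 'a) \<Rightarrow> 'a \<Rightarrow> 'k"
  where "dual_action R \<psi> \<xi> = compose (carrier R) \<psi> \<xi>"

text \<open>Its transport to \<open>R\<close> along \<open>\<phi> : R \<rightarrow> Hom\<^sub>k(R, k)\<close>, i.e. \<open>\<phi>(f \<cdot> \<xi>) = \<phi>(f) \<cdot> \<xi>\<close>.\<close>

definition pullback_action ::
    "('a, 'x) ring_scheme \<Rightarrow> ('a \<Rightarrow> 'a \<Rightarrow> 'k) \<Rightarrow> 'a \<Rightarrow> ('a \<Rightarrow> 'a) \<Rightarrow> 'a"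
  where "pullback_action R \<phi> f \<xi> = inv_into (carrier R) \<phi> (dual_action R (\<phi> f) \<xi>)"

text \<open>
  The correspondence \<open>\<Phi>(\<xi>)(f) = f \<cdot> \<xi>\<close> between anti-automorphisms of the ring of differential
  operators fixing \<open>R\<close> and compatible right module structures on \<open>R\<close>.
\<close>

definition corresponds_to_action ::
    "('k, 'x) ring_scheme \<Rightarrow> ('k, 'a, 'y) module_scheme
      \<Rightarrow> (('a \<Rightarrow> 'a) \<Rightarrow> ('a \<Rightarrow> 'a)) \<Rightarrow> ('a \<Rightarrow> ('a \<Rightarrow> 'a) \<Rightarrow> 'a) \<Rightarrow> bool"
  where "corresponds_to_action k R \<Phi> act \<longleftrightarrow>
    (\<forall>\<xi>\<in>carrier (diff_ops_ring k R). \<forall>f\<in>carrier R. \<Phi> \<xi> f = act f \<xi>)"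

end

theory Submission
  imports Defs
begin

text \<open>
  In the dual case \<open>\<Phi>\<close> is the adjoint with respect to the symmetric nondegenerate form
  \<open>(f, g) \<mapsto> \<sigma> (f g)\<close> with \<open>\<sigma> = \<phi>(1)\<close>, hence involutive.

  In the reduced case no localization is needed. If \<open>\<Phi>\<^sup>2 \<xi> \<noteq> \<xi>\<close>, take a nonzero value \<open>c\<close> of
  \<open>\<Phi>\<^sup>2 \<xi> - \<xi>\<close>; Gaussian elimination without division gives a dual basis up to a factor \<open>s\<close> with
  \<open>s c \<noteq> 0\<close>, which plays the role of a basis over the total ring of fractions.
  When positive integers are invertible, the dual basis consists of derivations \<open>\<theta>\<^sub>j\<close> and Euler's
  identity \<open>n \<xi> = \<Sum>\<^sub>j [\<xi>, x\<^sub>j] \<theta>\<^sub>j\<close> modulo lower order reduces the claim to operators of order at most 1,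
  where \<open>\<Phi> \<xi> + \<xi>\<close> is multiplication by a function.
  In positive characteristic every operator commutes with \<open>q\<close>-th powers for some \<open>q\<close>, and the dual
  basis consists of rank one operators \<open>\<theta>\<close> with central values: applying \<open>\<Phi>\<close> to
  \<open>\<theta> a \<theta> = \<theta>(a) \<theta>\<close> shows \<open>\<Phi>(\<theta>) w = w \<theta>\<close> for all \<open>w\<close> in the image of \<open>\<Phi>(\<theta>)\<close>, and applying \<open>\<Phi>\<close>
  again gives \<open>w \<Phi>\<^sup>2(\<theta>) = w \<theta>\<close>.
\<close>

section \<open>The ring of linear endomorphisms\<close>

locale algebra_operators = cring R
  for k :: "('k, 'x) ring_scheme" and R :: "('k, 'a, 'y) module_scheme" (structure) +
  assumes algebra: "algebra k R"
begin

abbreviation E where "E \<equiv> End_ring k R"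
abbreviation \<iota> where "\<iota> \<equiv> mult_op R"

lemma smult_in: "c \<in> carrier k \<Longrightarrow> x \<in> carrier R \<Longrightarrow> c \<odot>\<^bsub>R\<^esub> x \<in> carrier R"
  using module.smult_closed[OF algebra.module[OF algebra]] by blast

lemma smult_add: "c \<in> carrier k \<Longrightarrow> x \<in> carrier R \<Longrightarrow> y \<in> carrier R \<Longrightarrow>
    c \<odot>\<^bsub>R\<^esub> (x \<oplus> y) = c \<odot>\<^bsub>R\<^esub> x \<oplus> c \<odot>\<^bsub>R\<^esub> y"
  using module.smult_r_distr[OF algebra.module[OF algebra]] by blast

lemma smult_zero: "c \<in> carrier k \<Longrightarrow> c \<odot>\<^bsub>R\<^esub> \<zero> = \<zero>"
  using module.smult_r_null[OF algebra.module[OF algebra]] by blast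

lemma smult_minus: "c \<in> carrier k \<Longrightarrow> x \<in> carrier R \<Longrightarrow> c \<odot>\<^bsub>R\<^esub> (\<ominus> x) = \<ominus> (c \<odot>\<^bsub>R\<^esub> x)"
  using module.smult_r_minus[OF algebra.module[OF algebra]] by blast

lemma smult_mult: "c \<in> carrier k \<Longrightarrow> x \<in> carrier R \<Longrightarrow> y \<in> carrier R \<Longrightarrow>
    (c \<odot>\<^bsub>R\<^esub> x) \<otimes> y = c \<odot>\<^bsub>R\<^esub> (x \<otimes> y)"
  using algebra.smult_assoc2[OF algebra] by blast

lemma structure_map_mult:
  "c \<in> carrier k \<Longrightarrow> x \<in> carrier R \<Longrightarrow> structure_map R c \<otimes> x = c \<odot>\<^bsub>R\<^esub> x"
  by (simp add: structure_map_def smult_mult)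

lemma structure_map_closed: "c \<in> carrier k \<Longrightarrow> structure_map R c \<in> carrier R"
  by (simp add: structure_map_def smult_in)

lemma carrier_E: "carrier E = linear_maps k R R"
  by (simp add: End_ring_def)

lemma E_I:
  assumes "\<xi> \<in> extensional (carrier R)" "\<And>x. x \<in> carrier R \<Longrightarrow> \<xi> x \<in> carrier R"
    "\<And>x y. x \<in> carrier R \<Longrightarrow> y \<in> carrier R \<Longrightarrow> \<xi> (x \<oplus> y) = \<xi> x \<oplus> \<xi> y"
    "\<And>c x. c \<in> carrier k \<Longrightarrow> x \<in> carrier R \<Longrightarrow> \<xi> (c \<odot>\<^bsub>R\<^esub> x) = c \<odot>\<^bsub>R\<^esub> \<xi> x"
  shows "\<xi> \<in> carrier E"
  using assms unfolding carrier_E linear_maps_def by (auto simp: PiE_def)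

lemma
  assumes "\<xi> \<in> carrier E"
  shows E_closed: "x \<in> carrier R \<Longrightarrow> \<xi> x \<in> carrier R"
    and E_add: "x \<in> carrier R \<Longrightarrow> y \<in> carrier R \<Longrightarrow> \<xi> (x \<oplus> y) = \<xi> x \<oplus> \<xi> y"
    and E_smult: "c \<in> carrier k \<Longrightarrow> x \<in> carrier R \<Longrightarrow> \<xi> (c \<odot>\<^bsub>R\<^esub> x) = c \<odot>\<^bsub>R\<^esub> \<xi> x"
    and E_extensional: "\<xi> \<in> extensional (carrier R)"
  using assms unfolding carrier_E linear_maps_def by (auto simp: PiE_iff)

lemma E_eqI:
  assumes "\<xi> \<in> carrier E" "\<eta> \<in> carrier E" "\<And>x. x \<in> carrier R \<Longrightarrow> \<xi> x = \<eta> x"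
  shows "\<xi> = \<eta>"
  using assms E_extensional extensionalityI by metis

lemma
  assumes "x \<in> carrier R"
  shows E_mult_apply [simp]: "(\<xi> \<otimes>\<^bsub>E\<^esub> \<eta>) x = \<xi> (\<eta> x)"
    and E_add_apply [simp]: "(\<xi> \<oplus>\<^bsub>E\<^esub> \<eta>) x = \<xi> x \<oplus> \<eta> x"
    and E_zero_apply [simp]: "\<zero>\<^bsub>E\<^esub> x = \<zero>"
    and E_one_apply [simp]: "\<one>\<^bsub>E\<^esub> x = x"
    and \<iota>_apply [simp]: "\<iota> f x = f \<otimes> x"
  using assms by (simp_all add: End_ring_def compose_def mult_op_def)

lemma E_zero_closed: "\<zero>\<^bsub>E\<^esub> \<in> carrier E"
  by (rule E_I) (auto simp: End_ring_def smult_zero smult_in)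

lemma E_one_closed: "\<one>\<^bsub>E\<^esub> \<in> carrier E"
  by (rule E_I) (auto simp: End_ring_def smult_in)

lemma E_mult_closed: "\<xi> \<in> carrier E \<Longrightarrow> \<eta> \<in> carrier E \<Longrightarrow> \<xi> \<otimes>\<^bsub>E\<^esub> \<eta> \<in> carrier E"
  by (rule E_I) (auto simp: E_closed E_add E_smult smult_in, auto simp: End_ring_def compose_def)

lemma E_add_closed: "\<xi> \<in> carrier E \<Longrightarrow> \<eta> \<in> carrier E \<Longrightarrow> \<xi> \<oplus>\<^bsub>E\<^esub> \<eta> \<in> carrier E"
  by (rule E_I) (auto simp: E_closed E_add E_smult smult_in smult_add a_ac, auto simp: End_ring_def)

lemma \<iota>_closed [simp, intro]: "f \<in> carrier R \<Longrightarrow> \<iota> f \<in> carrier E"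
  by (rule E_I) (auto simp: smult_in r_distr smult_mult m_comm[of f], auto simp: mult_op_def)

text \<open>Once operators are elements of a ring, the commutator identities below become formal
  ring identities; only the axioms here are checked pointwise.\<close>

lemma E_ring: "ring E"
proof (rule ringI)
  show "abelian_group E"
  proof (rule abelian_groupI)
    fix \<xi> assume \<xi>: "\<xi> \<in> carrier E"
    define \<eta> where "\<eta> = (\<lambda>x\<in>carrier R. \<ominus> \<xi> x)"
    have "\<eta> \<in> carrier E"
      by (rule E_I) (auto simp: \<eta>_def E_closed[OF \<xi>] E_add[OF \<xi>] E_smult[OF \<xi>] smult_in smult_minus minus_add)
    moreover have "\<eta> \<oplus>\<^bsub>E\<^esub> \<xi> = \<zero>\<^bsub>E\<^esub>"
      by (rule E_eqI[OF E_add_closed E_zero_closed])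
        (use \<open>\<eta> \<in> carrier E\<close> \<xi> in \<open>auto simp: \<eta>_def l_neg E_closed\<close>)
    ultimately show "\<exists>\<eta>\<in>carrier E. \<eta> \<oplus>\<^bsub>E\<^esub> \<xi> = \<zero>\<^bsub>E\<^esub>" by blast
  qed (auto intro!: E_eqI E_add_closed E_zero_closed simp: a_ac E_closed)
  show "monoid E"
    by (rule monoidI) (auto intro!: E_eqI E_mult_closed E_one_closed simp: E_closed)
qed (auto intro!: E_eqI E_mult_closed E_add_closed simp: E_add E_closed)

end

sublocale algebra_operators \<subseteq> E: ring "End_ring k R"
  by (rule E_ring)

context algebra_operators
begin

lemma E_zero [simp]: "\<xi> \<in> carrier E \<Longrightarrow> \<xi> \<zero> = \<zero>"
  by (metis E_add E_closed r_zero zero_closed add.r_cancel_one')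

lemma E_neg_apply [simp]:
  assumes "\<xi> \<in> carrier E" "x \<in> carrier R"
  shows "(\<ominus>\<^bsub>E\<^esub> \<xi>) x = \<ominus> \<xi> x"
proof -
  have "(\<ominus>\<^bsub>E\<^esub> \<xi> \<oplus>\<^bsub>E\<^esub> \<xi>) x = \<zero>" using assms by (simp only: E.l_neg E_zero_apply)
  then show ?thesis using assms by (metis E_add_apply E_closed E.a_inv_closed minus_equality)
qed

lemma E_minus_apply [simp]:
  "\<xi> \<in> carrier E \<Longrightarrow> \<eta> \<in> carrier E \<Longrightarrow> x \<in> carrier R \<Longrightarrow> (\<xi> \<ominus>\<^bsub>E\<^esub> \<eta>) x = \<xi> x \<ominus> \<eta> x"
  by (simp add: a_minus_def)

lemma E_neg: "\<xi> \<in> carrier E \<Longrightarrow> x \<in> carrier R \<Longrightarrow> \<xi> (\<ominus> x) = \<ominus> \<xi> x"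
  by (metis E_add E_closed E_zero a_inv_closed l_neg minus_equality)

lemma \<iota>_mult: "f \<in> carrier R \<Longrightarrow> g \<in> carrier R \<Longrightarrow> \<iota> (f \<otimes> g) = \<iota> f \<otimes>\<^bsub>E\<^esub> \<iota> g"
  by (rule E_eqI) (auto simp: m_assoc)

lemma \<iota>_add: "f \<in> carrier R \<Longrightarrow> g \<in> carrier R \<Longrightarrow> \<iota> (f \<oplus> g) = \<iota> f \<oplus>\<^bsub>E\<^esub> \<iota> g"
  by (rule E_eqI) (auto simp: l_distr)

lemma \<iota>_one: "\<iota> \<one> = \<one>\<^bsub>E\<^esub>"
  by (rule E_eqI) auto

lemma \<iota>_zero: "\<iota> \<zero> = \<zero>\<^bsub>E\<^esub>"
  by (rule E_eqI) auto

lemma \<iota>_comm: "f \<in> carrier R \<Longrightarrow> g \<in> carrier R \<Longrightarrow> \<iota> f \<otimes>\<^bsub>E\<^esub> \<iota> g = \<iota> g \<otimes>\<^bsub>E\<^esub> \<iota> f"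
  by (metis \<iota>_mult m_comm)

section \<open>The order filtration\<close>

text \<open>This is the commutator [\<xi>, f], written with the ring operations of \<open>E\<close>
  so that ring calculus applies to it.\<close>

definition ad :: "'a \<Rightarrow> ('a \<Rightarrow> 'a) \<Rightarrow> 'a \<Rightarrow> 'a" where
  "ad f \<xi> = \<xi> \<otimes>\<^bsub>E\<^esub> \<iota> f \<ominus>\<^bsub>E\<^esub> \<iota> f \<otimes>\<^bsub>E\<^esub> \<xi>"

text \<open>The index is shifted by one: \<open>order_below (Suc n)\<close> holds the operators of
  order at most n. Starting from the zero operator makes base cases trivial, and that order zero
  means multiplication by a function becomes a lemma.\<close>

primrec order_below :: "nat \<Rightarrow> ('a \<Rightarrow> 'a) set" where
  "order_below 0 = {\<zero>\<^bsub>E\<^esub>}"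
| "order_below (Suc n) = {\<xi> \<in> carrier E. \<forall>f\<in>carrier R. ad f \<xi> \<in> order_below n}"

lemma ad_closed [simp, intro]: "f \<in> carrier R \<Longrightarrow> \<xi> \<in> carrier E \<Longrightarrow> ad f \<xi> \<in> carrier E"
  by (simp add: ad_def)

lemma ad_apply [simp]: "f \<in> carrier R \<Longrightarrow> \<xi> \<in> carrier E \<Longrightarrow> x \<in> carrier R \<Longrightarrow>
   ad f \<xi> x = \<xi> (f \<otimes> x) \<ominus> f \<otimes> \<xi> x"
  by (simp add: ad_def E_closed)

lemma order_below_closed: "\<xi> \<in> order_below n \<Longrightarrow> \<xi> \<in> carrier E"
  by (cases n) auto

lemma ad_zero: "f \<in> carrier R \<Longrightarrow> ad f \<zero>\<^bsub>E\<^esub> = \<zero>\<^bsub>E\<^esub>"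
  by (simp add: ad_def E.minus_eq)

lemma ad_\<iota>: "f \<in> carrier R \<Longrightarrow> g \<in> carrier R \<Longrightarrow> ad f (\<iota> g) = \<zero>\<^bsub>E\<^esub>"
  by (simp add: ad_def \<iota>_comm[of g f] E.minus_eq E.r_neg)

lemma ad_add:
  assumes "f \<in> carrier R" "\<xi> \<in> carrier E" "\<eta> \<in> carrier E"
  shows "ad f (\<xi> \<oplus>\<^bsub>E\<^esub> \<eta>) = ad f \<xi> \<oplus>\<^bsub>E\<^esub> ad f \<eta>"
proof -
  have "\<iota> f \<in> carrier E" using assms by simp
  with assms(2,3) show ?thesis unfolding ad_def by algebra
qed

lemma ad_mult:
  assumes "f \<in> carrier R" "\<xi> \<in> carrier E" "\<eta> \<in> carrier E"
  shows "ad f (\<xi> \<otimes>\<^bsub>E\<^esub> \<eta>) = \<xi> \<otimes>\<^bsub>E\<^esub> ad f \<eta> \<oplus>\<^bsub>E\<^esub> ad f \<xi> \<otimes>\<^bsub>E\<^esub> \<eta>"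
proof -
  have "\<iota> f \<in> carrier E" using assms by simp
  with assms(2,3) show ?thesis unfolding ad_def by algebra
qed

lemma ad_minus_op:
  assumes "f \<in> carrier R" "\<xi> \<in> carrier E" "\<eta> \<in> carrier E"
  shows "ad f (\<xi> \<ominus>\<^bsub>E\<^esub> \<eta>) = ad f \<xi> \<ominus>\<^bsub>E\<^esub> ad f \<eta>"
proof -
  have "\<iota> f \<in> carrier E" using assms by simp
  with assms(2,3) show ?thesis unfolding ad_def by algebra
qed

text \<open>Multiplication operators commute with each other, so the Jacobi identity has no third
  term.\<close>

lemma ad_comm:
  assumes "f \<in> carrier R" "g \<in> carrier R" "\<xi> \<in> carrier E"
  shows "ad f (ad g \<xi>) = ad g (ad f \<xi>)"
proof (rule E_eqI)
  fix x assume x: "x \<in> carrier R"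
  have swap: "(a \<ominus> g \<otimes> b) \<ominus> f \<otimes> (c \<ominus> g \<otimes> d) = (a \<ominus> f \<otimes> c) \<ominus> g \<otimes> (b \<ominus> f \<otimes> d)"
    if "a \<in> carrier R" "b \<in> carrier R" "c \<in> carrier R" "d \<in> carrier R" for a b c d
    using that assms(1,2) by algebra
  have "\<xi> (g \<otimes> (f \<otimes> x)) = \<xi> (f \<otimes> (g \<otimes> x))" using assms x by (simp add: m_lcomm[of g f x])
  with assms x show "ad f (ad g \<xi>) x = ad g (ad f \<xi>) x"
    using E_closed[OF assms(3)] swap[of "\<xi> (g \<otimes> (f \<otimes> x))" "\<xi> (f \<otimes> x)" "\<xi> (g \<otimes> x)" "\<xi> x"] by simp
qed (use assms in auto)

lemma ad_prod:
  assumes "f \<in> carrier R" "g \<in> carrier R" "\<xi> \<in> carrier E"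
  shows "ad (f \<otimes> g) \<xi> = ad f \<xi> \<otimes>\<^bsub>E\<^esub> \<iota> g \<oplus>\<^bsub>E\<^esub> \<iota> f \<otimes>\<^bsub>E\<^esub> ad g \<xi>"
proof -
  have "\<iota> f \<in> carrier E" "\<iota> g \<in> carrier E" using assms by auto
  then show ?thesis using assms(3) unfolding ad_def \<iota>_mult[OF assms(1,2)] by algebra
qed

lemma zero_order_below: "\<zero>\<^bsub>E\<^esub> \<in> order_below n"
  by (induction n) (auto simp: ad_zero)

lemma order_below_add:
  "\<xi> \<in> order_below n \<Longrightarrow> \<eta> \<in> order_below n \<Longrightarrow> \<xi> \<oplus>\<^bsub>E\<^esub> \<eta> \<in> order_below n"
  by (induction n arbitrary: \<xi> \<eta>) (auto simp: ad_add)

lemma order_below_minus: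
  "\<xi> \<in> order_below n \<Longrightarrow> \<eta> \<in> order_below n \<Longrightarrow> \<xi> \<ominus>\<^bsub>E\<^esub> \<eta> \<in> order_below n"
proof (induction n arbitrary: \<xi> \<eta>)
  case 0
  then show ?case by (simp add: E.minus_eq)
qed (auto simp: ad_minus_op)

lemma order_below_mono: "m \<le> n \<Longrightarrow> \<xi> \<in> order_below m \<Longrightarrow> \<xi> \<in> order_below n"
proof (induction m arbitrary: n \<xi>)
  case 0
  then show ?case by (auto simp: zero_order_below)
next
  case (Suc m)
  then show ?case by (cases n) auto
qed

text \<open>Each term of the Leibniz rule \<open>ad_mult\<close> lowers the index of just one
  factor, hence the induction on the sum of the indices. Orders m-1 and n-1 add up to m+n-2, which
  is index m+n-1.\<close>

lemma order_below_mult: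
  "\<xi> \<in> order_below m \<Longrightarrow> \<eta> \<in> order_below n \<Longrightarrow> \<xi> \<otimes>\<^bsub>E\<^esub> \<eta> \<in> order_below (m + n - 1)"
proof (induction "m + n" arbitrary: m n \<xi> \<eta>)
  case 0
  then show ?case by simp
next
  case (Suc l)
  note c = order_below_closed[OF Suc.prems(1)] order_below_closed[OF Suc.prems(2)]
  show ?case
  proof (cases "m = 0 \<or> n = 0")
    case True
    \<comment> \<open>A factor of index 0 is zero, which also disposes of the truncated
      subtraction.\<close>
    then have "\<xi> = \<zero>\<^bsub>E\<^esub> \<or> \<eta> = \<zero>\<^bsub>E\<^esub>" using Suc.prems by auto
    then show ?thesis using zero_order_below c by auto
  next
    case False
    then obtain m' n' where mn: "m = Suc m'" "n = Suc n'" by (meson not0_implies_Suc)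
    show ?thesis unfolding mn
    proof (simp add: c, intro ballI)
      fix f assume f: "f \<in> carrier R"
      then have a: "ad f \<xi> \<in> order_below m'" "ad f \<eta> \<in> order_below n'" using Suc.prems mn by auto
      have "\<xi> \<otimes>\<^bsub>E\<^esub> ad f \<eta> \<in> order_below (m' + n')"
        using Suc.hyps(1)[OF _ Suc.prems(1) a(2)] Suc.hyps(2) mn by simp
      moreover have "ad f \<xi> \<otimes>\<^bsub>E\<^esub> \<eta> \<in> order_below (m' + n')"
        using Suc.hyps(1)[OF _ a(1) Suc.prems(2)] Suc.hyps(2) mn by simp
      ultimately show "ad f (\<xi> \<otimes>\<^bsub>E\<^esub> \<eta>) \<in> order_below (m' + n')"
        using f c by (simp add: ad_mult order_below_add)
    qed
  qed
qed

text \<open>An operator that commutes with all multiplications is R-linear, hence multiplication by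
  its value at 1.\<close>

lemma order_below_1: "order_below (Suc 0) = \<iota> ` carrier R"
proof
  show "order_below (Suc 0) \<subseteq> \<iota> ` carrier R"
  proof
    fix \<xi> assume "\<xi> \<in> order_below (Suc 0)"
    then have \<xi>: "\<xi> \<in> carrier E" and ad: "\<And>f. f \<in> carrier R \<Longrightarrow> ad f \<xi> = \<zero>\<^bsub>E\<^esub>" by auto
    have "\<xi> f = \<iota> (\<xi> \<one>) f" if f: "f \<in> carrier R" for f
    proof -
      have "\<xi> (f \<otimes> \<one>) \<ominus> f \<otimes> \<xi> \<one> = \<zero>"
        using ad[OF f] ad_apply[OF f \<xi>, of \<one>] by simp
      then have "\<xi> f = f \<otimes> \<xi> \<one>" using f E_closed[OF \<xi>] r_right_minus_eq by auto
      also have "\<dots> = \<xi> \<one> \<otimes> f" using f E_closed[OF \<xi>] m_comm by auto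
      also have "\<dots> = \<iota> (\<xi> \<one>) f" using f by (simp only: \<iota>_apply)
      finally show ?thesis .
    qed
    then have "\<xi> = \<iota> (\<xi> \<one>)"
      by (intro E_eqI[OF \<xi> \<iota>_closed] E_closed[OF \<xi>] one_closed)
    then show "\<xi> \<in> \<iota> ` carrier R" by (rule image_eqI) (intro E_closed[OF \<xi>] one_closed)
  qed
qed (auto simp: ad_\<iota>)

section \<open>Agreement with the filtration that defines differential operators\<close>

lemma commutator_eq_ad:
  assumes "\<xi> \<in> carrier E" "f \<in> carrier R"
  shows "commutator R \<xi> f = ad f \<xi>"
proof (rule extensionalityI)
  show "commutator R \<xi> f \<in> extensional (carrier R)" by (simp add: commutator_def)
  show "ad f \<xi> \<in> extensional (carrier R)" using assms by (intro E_extensional) auto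
qed (use assms in \<open>simp add: commutator_def\<close>)

lemma diff_ops_upto_eq: "diff_ops_upto k R n = order_below (Suc n)"
proof (induction n)
  case 0
  then show ?case by (simp only: order_below_1 diff_ops_upto.simps)
next
  case (Suc n)
  show ?case
  proof (intro equalityI subsetI)
    fix \<xi> assume "\<xi> \<in> diff_ops_upto k R (Suc n)"
    then have "\<xi> \<in> carrier E" "\<And>f. f \<in> carrier R \<Longrightarrow> commutator R \<xi> f \<in> order_below (Suc n)"
      by (auto simp only: carrier_E diff_ops_upto.simps Suc.IH)
    then show "\<xi> \<in> order_below (Suc (Suc n))"
      using commutator_eq_ad by (simp only: order_below.simps(2)[of "Suc n"] mem_Collect_eq) metis
  next
    fix \<xi> assume "\<xi> \<in> order_below (Suc (Suc n))"
    then have "\<xi> \<in> carrier E" "\<And>f. f \<in> carrier R \<Longrightarrow> ad f \<xi> \<in> order_below (Suc n)"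
      by (simp_all only: order_below.simps(2)[of "Suc n"] mem_Collect_eq)
    then show "\<xi> \<in> diff_ops_upto k R (Suc n)"
      using commutator_eq_ad by (simp only: diff_ops_upto.simps(2) Suc.IH carrier_E mem_Collect_eq) metis
  qed
qed

section \<open>Closure properties of the set of differential operators\<close>

abbreviation D where "D \<equiv> carrier (diff_ops_ring k R)"

lemma D_eq: "D = (\<Union>n. order_below n)"
proof
  have "D = (\<Union>n. order_below (Suc n))" by (simp add: diff_ops_ring_def diff_ops_upto_eq del: order_below.simps)
  then show "D \<subseteq> (\<Union>n. order_below n)" "(\<Union>n. order_below n) \<subseteq> D"
    using order_below_mono[OF le_SucI[OF order_refl]] by blast+
qed

lemma D_ops:
  "\<zero>\<^bsub>diff_ops_ring k R\<^esub> = \<zero>\<^bsub>E\<^esub>" "\<one>\<^bsub>diff_ops_ring k R\<^esub> = \<one>\<^bsub>E\<^esub>"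
  "(\<oplus>\<^bsub>diff_ops_ring k R\<^esub>) = (\<oplus>\<^bsub>E\<^esub>)" "(\<otimes>\<^bsub>diff_ops_ring k R\<^esub>) = (\<otimes>\<^bsub>E\<^esub>)"
  by (simp_all add: diff_ops_ring_def)

lemma D_E [simp, intro]: "\<xi> \<in> D \<Longrightarrow> \<xi> \<in> carrier E"
  unfolding D_eq using order_below_closed by blast

lemma order_below_D: "\<xi> \<in> order_below n \<Longrightarrow> \<xi> \<in> D"
  unfolding D_eq by blast

lemma D_\<iota> [simp, intro]: "f \<in> carrier R \<Longrightarrow> \<iota> f \<in> D"
  using order_below_1 order_below_D by blast

lemma D_zero [simp, intro]: "\<zero>\<^bsub>E\<^esub> \<in> D"
  using zero_order_below order_below_D by blast

lemma D_two:
  assumes "\<xi> \<in> D" "\<eta> \<in> D"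
  obtains n where "\<xi> \<in> order_below n" "\<eta> \<in> order_below n"
  using assms unfolding D_eq by (metis UN_E max.cobounded1 max.cobounded2 order_below_mono)

lemma D_add [simp, intro]: "\<xi> \<in> D \<Longrightarrow> \<eta> \<in> D \<Longrightarrow> \<xi> \<oplus>\<^bsub>E\<^esub> \<eta> \<in> D"
  by (metis D_two order_below_add order_below_D)

lemma D_minus [simp, intro]: "\<xi> \<in> D \<Longrightarrow> \<eta> \<in> D \<Longrightarrow> \<xi> \<ominus>\<^bsub>E\<^esub> \<eta> \<in> D"
  by (metis D_two order_below_minus order_below_D)

lemma D_mult [simp, intro]: "\<xi> \<in> D \<Longrightarrow> \<eta> \<in> D \<Longrightarrow> \<xi> \<otimes>\<^bsub>E\<^esub> \<eta> \<in> D"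
  by (metis D_two order_below_mult order_below_D)

lemma D_ad [simp, intro]: "f \<in> carrier R \<Longrightarrow> \<xi> \<in> D \<Longrightarrow> ad f \<xi> \<in> D"
  unfolding ad_def by blast

text \<open>If [\<xi>, h] commutes with h, the commutator with powers of h obeys the usual power
  rule; \<open>ad_prod\<close> supplies the induction step.\<close>

lemma ad_pow:
  assumes h: "h \<in> carrier R" and \<xi>: "\<xi> \<in> carrier E" and ad2: "ad h (ad h \<xi>) = \<zero>\<^bsub>E\<^esub>"
  shows "ad (h [^] Suc m) \<xi> = \<iota> (add_pow R (Suc m) \<one> \<otimes> h [^] m) \<otimes>\<^bsub>E\<^esub> ad h \<xi>"
proof (induction m)
  case 0
  then show ?case using h \<xi> by (simp add: \<iota>_one)
next
  case (Suc m)
  have c: "\<iota> h \<in> carrier E" "ad h \<xi> \<in> carrier E" "\<iota> (h [^] Suc m) \<in> carrier E" using h \<xi> by auto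
  have comm: "ad h \<xi> \<otimes>\<^bsub>E\<^esub> \<iota> h = \<iota> h \<otimes>\<^bsub>E\<^esub> ad h \<xi>"
    using ad2 c unfolding ad_def[of h "ad h \<xi>"] by simp
  have n: "add_pow R (Suc m) \<one> \<in> carrier R" "h [^] m \<in> carrier R" using h by auto
  have n': "add_pow R (Suc m) \<one> \<otimes> h [^] m \<in> carrier R" using n by blast
  have "ad (h [^] Suc (Suc m)) \<xi>
      = ad (h [^] Suc m) \<xi> \<otimes>\<^bsub>E\<^esub> \<iota> h \<oplus>\<^bsub>E\<^esub> \<iota> (h [^] Suc m) \<otimes>\<^bsub>E\<^esub> ad h \<xi>"
    using ad_prod[of "h [^] Suc m" h \<xi>] h \<xi> by simp
  also have "\<dots> = \<iota> (add_pow R (Suc m) \<one> \<otimes> h [^] m) \<otimes>\<^bsub>E\<^esub> \<iota> h \<otimes>\<^bsub>E\<^esub> ad h \<xi>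
      \<oplus>\<^bsub>E\<^esub> \<iota> (h [^] Suc m) \<otimes>\<^bsub>E\<^esub> ad h \<xi>"
    unfolding Suc.IH using c n' comm by (simp add: E.m_assoc \<iota>_closed[OF n'] del: add.nat_pow_Suc)
  also have "\<dots> = (\<iota> (add_pow R (Suc m) \<one> \<otimes> h [^] m \<otimes> h) \<oplus>\<^bsub>E\<^esub> \<iota> (h [^] Suc m)) \<otimes>\<^bsub>E\<^esub> ad h \<xi>"
    using c n' h by (simp add: E.l_distr \<iota>_mult[OF n'] \<iota>_closed[OF n'] del: add.nat_pow_Suc nat_pow_Suc)
  also have "\<iota> (add_pow R (Suc m) \<one> \<otimes> h [^] m \<otimes> h) \<oplus>\<^bsub>E\<^esub> \<iota> (h [^] Suc m)
      = \<iota> (add_pow R (Suc m) \<one> \<otimes> h [^] m \<otimes> h \<oplus> h [^] Suc m)"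
    using n n' h by (subst \<iota>_add) auto
  also have "add_pow R (Suc m) \<one> \<otimes> h [^] m \<otimes> h \<oplus> h [^] Suc m = add_pow R (Suc (Suc m)) \<one> \<otimes> h [^] Suc m"
    using n h by (simp add: l_distr m_assoc)
  finally show ?case .
qed

text \<open>By the power rule the commutator with h^p carries the factor p, which is zero in R. So
  each further p-th power lets operators of one more order commute.\<close>

lemma ad_pow_char:
  assumes p: "0 < p" "add_pow R (p::nat) \<one> = \<zero>"
  shows "\<xi> \<in> order_below (Suc n) \<Longrightarrow> f \<in> carrier R \<Longrightarrow> ad (f [^] (p ^ n)) \<xi> = \<zero>\<^bsub>E\<^esub>"
proof (induction n arbitrary: \<xi>)
  case 0
  then show ?case by simp
next
  case (Suc n)
  let ?h = "f [^] (p ^ n)"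
  obtain m where m: "p = Suc m" using p(1) by (cases p) auto
  have \<xi>: "\<xi> \<in> carrier E" and h: "?h \<in> carrier R"
    using Suc.prems order_below_closed by auto
  \<comment> \<open>Since [\<xi>, h] has one order less, the induction hypothesis makes it commute
    with h, as \<open>ad_pow\<close> requires.\<close>
  have "ad ?h \<xi> \<in> order_below (Suc n)"
    using Suc.prems(1) h unfolding order_below.simps(2)[of "Suc n"] by blast
  then have "ad ?h (ad ?h \<xi>) = \<zero>\<^bsub>E\<^esub>" using Suc.IH Suc.prems(2) by blast
  then have "ad (?h [^] p) \<xi> = \<iota> (add_pow R p \<one> \<otimes> ?h [^] m) \<otimes>\<^bsub>E\<^esub> ad ?h \<xi>"
    using ad_pow[OF h \<xi>, of m] m by simp
  also have "\<dots> = \<zero>\<^bsub>E\<^esub>" using p(2) h \<xi> by (simp add: \<iota>_zero)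
  also have "?h [^] p = f [^] (p ^ Suc n)"
    using Suc.prems by (simp add: nat_pow_pow mult.commute)
  finally show ?case .
qed

end

section \<open>Anti-automorphisms fixing the algebra\<close>

locale anti_automorphism = algebra_operators k R
  for k :: "('k, 'x) ring_scheme" and R :: "('k, 'a, 'y) module_scheme" (structure) +
  fixes \<Phi> :: "('a \<Rightarrow> 'a) \<Rightarrow> ('a \<Rightarrow> 'a)"
  assumes anti: "ring_anti_automorphism (diff_ops_ring k R) \<Phi>"
    and \<Phi>_\<iota>: "f \<in> carrier R \<Longrightarrow> \<Phi> (mult_op R f) = mult_op R f"
begin

lemma \<Phi>_D [simp, intro]: "\<xi> \<in> D \<Longrightarrow> \<Phi> \<xi> \<in> D"
  using anti unfolding ring_anti_automorphism_def bij_betw_def by blast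

lemma \<Phi>_inj: "\<xi> \<in> D \<Longrightarrow> \<eta> \<in> D \<Longrightarrow> \<Phi> \<xi> = \<Phi> \<eta> \<Longrightarrow> \<xi> = \<eta>"
  using anti unfolding ring_anti_automorphism_def bij_betw_def inj_on_def by blast

lemma \<Phi>_add: "\<xi> \<in> D \<Longrightarrow> \<eta> \<in> D \<Longrightarrow> \<Phi> (\<xi> \<oplus>\<^bsub>E\<^esub> \<eta>) = \<Phi> \<xi> \<oplus>\<^bsub>E\<^esub> \<Phi> \<eta>"
  using anti unfolding ring_anti_automorphism_def D_ops by blast

lemma \<Phi>_mult: "\<xi> \<in> D \<Longrightarrow> \<eta> \<in> D \<Longrightarrow> \<Phi> (\<xi> \<otimes>\<^bsub>E\<^esub> \<eta>) = \<Phi> \<eta> \<otimes>\<^bsub>E\<^esub> \<Phi> \<xi>"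
  using anti unfolding ring_anti_automorphism_def D_ops by blast

lemma \<Phi>_zero: "\<Phi> \<zero>\<^bsub>E\<^esub> = \<zero>\<^bsub>E\<^esub>"
  using \<Phi>_\<iota>[of \<zero>] by (simp add: \<iota>_zero)

lemma \<Phi>_minus:
  assumes "\<xi> \<in> D" "\<eta> \<in> D"
  shows "\<Phi> (\<xi> \<ominus>\<^bsub>E\<^esub> \<eta>) = \<Phi> \<xi> \<ominus>\<^bsub>E\<^esub> \<Phi> \<eta>"
proof -
  have d: "\<xi> \<ominus>\<^bsub>E\<^esub> \<eta> \<in> D" using assms by blast
  have "\<xi> = (\<xi> \<ominus>\<^bsub>E\<^esub> \<eta>) \<oplus>\<^bsub>E\<^esub> \<eta>" using D_E[OF assms(1)] D_E[OF assms(2)]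
    by (simp add: E.minus_eq E.a_assoc E.l_neg)
  then have "\<Phi> \<xi> = \<Phi> (\<xi> \<ominus>\<^bsub>E\<^esub> \<eta>) \<oplus>\<^bsub>E\<^esub> \<Phi> \<eta>" using \<Phi>_add[OF d assms(2)] by simp
  moreover have "\<Phi> (\<xi> \<ominus>\<^bsub>E\<^esub> \<eta>) \<in> carrier E" "\<Phi> \<eta> \<in> carrier E" using d assms by auto
  ultimately show ?thesis by (simp add: E.minus_eq E.a_assoc E.r_neg)
qed

text \<open>\<open>\<Phi>\<close> fixes f and swaps the two products in the commutator; hence the
  sign.\<close>

lemma \<Phi>_ad:
  assumes "f \<in> carrier R" "\<xi> \<in> D"
  shows "\<Phi> (ad f \<xi>) = \<ominus>\<^bsub>E\<^esub> ad f (\<Phi> \<xi>)"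
proof -
  have "\<Phi> (ad f \<xi>) = \<iota> f \<otimes>\<^bsub>E\<^esub> \<Phi> \<xi> \<ominus>\<^bsub>E\<^esub> \<Phi> \<xi> \<otimes>\<^bsub>E\<^esub> \<iota> f"
    using assms unfolding ad_def by (simp add: \<Phi>_minus D_mult \<Phi>_mult \<Phi>_\<iota>)
  moreover have "\<iota> f \<in> carrier E" "\<Phi> \<xi> \<in> carrier E" using assms by auto
  ultimately show ?thesis unfolding ad_def by algebra
qed

text \<open>Here [\<xi>, f] is a function and thus fixed by \<open>\<Phi>\<close>, so by
  \<open>\<Phi>_ad\<close> the sum of \<xi> and its image commutes with every f and is itself a
  function. Applying \<open>\<Phi>\<close> to this sum leaves it unchanged; cancelling
  \<open>\<Phi> \<xi>\<close> gives the claim.\<close>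

lemma \<Phi>\<Phi>_order_1:
  assumes "\<xi> \<in> order_below (Suc (Suc 0))"
  shows "\<Phi> (\<Phi> \<xi>) = \<xi>"
proof -
  have \<xi>: "\<xi> \<in> D" using assms order_below_D by blast
  then have c: "\<Phi> \<xi> \<in> carrier E" "\<xi> \<in> carrier E" by auto
  have "ad f (\<Phi> \<xi> \<oplus>\<^bsub>E\<^esub> \<xi>) = \<zero>\<^bsub>E\<^esub>" if f: "f \<in> carrier R" for f
  proof -
    have "ad f \<xi> \<in> \<iota> ` carrier R"
      using assms f unfolding order_below.simps(2)[of "Suc 0"] order_below_1 by blast
    then have "\<Phi> (ad f \<xi>) = ad f \<xi>" using \<Phi>_\<iota> by (elim imageE) simp
    then have "ad f \<xi> = \<ominus>\<^bsub>E\<^esub> ad f (\<Phi> \<xi>)" using \<Phi>_ad[OF f \<xi>] by simp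
    then have "ad f (\<Phi> \<xi> \<oplus>\<^bsub>E\<^esub> \<xi>) = ad f (\<Phi> \<xi>) \<oplus>\<^bsub>E\<^esub> \<ominus>\<^bsub>E\<^esub> ad f (\<Phi> \<xi>)"
      using ad_add[OF f c] by simp
    also have "\<dots> = \<zero>\<^bsub>E\<^esub>" using f c E.r_neg by blast
    finally show ?thesis .
  qed
  then have "\<Phi> \<xi> \<oplus>\<^bsub>E\<^esub> \<xi> \<in> \<iota> ` carrier R"
    using c unfolding order_below_1[symmetric] by simp
  then obtain a where a: "a \<in> carrier R" "\<Phi> \<xi> \<oplus>\<^bsub>E\<^esub> \<xi> = \<iota> a" by blast
  have "\<Phi> (\<Phi> \<xi>) \<oplus>\<^bsub>E\<^esub> \<Phi> \<xi> = \<Phi> (\<Phi> \<xi> \<oplus>\<^bsub>E\<^esub> \<xi>)"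
    using \<Phi>_add[of "\<Phi> \<xi>" \<xi>] \<xi> by (simp only: \<Phi>_D)
  also have "\<dots> = \<Phi> \<xi> \<oplus>\<^bsub>E\<^esub> \<xi>" unfolding a(2) by (rule \<Phi>_\<iota>[OF a(1)])
  finally have "\<Phi> (\<Phi> \<xi>) \<oplus>\<^bsub>E\<^esub> \<Phi> \<xi> = \<Phi> \<xi> \<oplus>\<^bsub>E\<^esub> \<xi>" .
  moreover have "\<Phi> (\<Phi> \<xi>) \<in> carrier E" using \<xi> by blast
  ultimately show ?thesis using c E.a_comm[OF c] E.add.r_cancel[of "\<Phi> \<xi>" "\<Phi> (\<Phi> \<xi>)" \<xi>] by simp
qed

end

section \<open>Elimination\<close>

context algebra_operators
begin

text \<open>V is a module of operators determined by their values on the finite set B. Take J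
  maximal among the subsets of B with a dual system up to a factor s. In a ring with zero divisors a
  nonzero s says too little, so the element c that must survive is carried along in the condition
  that s c is nonzero.\<close>

lemma elimination:
  assumes V: "V \<subseteq> carrier E" "\<And>a \<xi>. a \<in> carrier R \<Longrightarrow> \<xi> \<in> V \<Longrightarrow> \<iota> a \<otimes>\<^bsub>E\<^esub> \<xi> \<in> V"
      "\<And>\<xi> \<eta>. \<xi> \<in> V \<Longrightarrow> \<eta> \<in> V \<Longrightarrow> \<xi> \<ominus>\<^bsub>E\<^esub> \<eta> \<in> V"
    and B: "finite B" "B \<subseteq> carrier R"
    and det: "\<And>\<xi>. \<xi> \<in> V \<Longrightarrow> (\<And>b. b \<in> B \<Longrightarrow> \<xi> b = \<zero>) \<Longrightarrow> \<xi> = \<zero>\<^bsub>E\<^esub>"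
    and c: "c \<in> carrier R" "c \<noteq> \<zero>"
  obtains J s \<theta> where "J \<subseteq> B" "s \<in> carrier R" "s \<otimes> c \<noteq> \<zero>" "\<And>j. j \<in> J \<Longrightarrow> \<theta> j \<in> V"
    "\<And>i j. i \<in> J \<Longrightarrow> j \<in> J \<Longrightarrow> \<theta> j i = (if i = j then s else \<zero>)"
    "\<And>\<xi>. \<xi> \<in> V \<Longrightarrow> (\<And>j. j \<in> J \<Longrightarrow> \<xi> j = \<zero>) \<Longrightarrow> \<iota> (s \<otimes> c) \<otimes>\<^bsub>E\<^esub> \<xi> = \<zero>\<^bsub>E\<^esub>"
proof -
  define Q where "Q J s \<theta> \<longleftrightarrow> s \<in> carrier R \<and> s \<otimes> c \<noteq> \<zero> \<and> (\<forall>j\<in>J. \<theta> j \<in> V) \<and>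
    (\<forall>i\<in>J. \<forall>j\<in>J. \<theta> j i = (if i = j then s else \<zero>))" for J s and \<theta> :: "'a \<Rightarrow> 'a \<Rightarrow> 'a"
  let ?S = "{J. J \<subseteq> B \<and> (\<exists>s \<theta>. Q J s \<theta>)}"
  \<comment> \<open>Elimination starts from the empty set with factor one, which is admissible
    because c is nonzero.\<close>
  have "Q {} \<one> (\<lambda>_. \<zero>\<^bsub>E\<^esub>)" using c by (simp add: Q_def)
  then have "{} \<in> ?S" by blast
  moreover have "finite ?S" using B by simp
  ultimately obtain J where J: "J \<in> ?S" and max: "\<And>J'. J' \<in> ?S \<Longrightarrow> J \<subseteq> J' \<Longrightarrow> J = J'"
    using finite_has_maximal[of ?S] by (metis (no_types, lifting) empty_iff)
  obtain s \<theta> where Q: "Q J s \<theta>" and JB: "J \<subseteq> B" using J by blast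
  have s: "s \<in> carrier R" "s \<otimes> c \<noteq> \<zero>"
    and \<theta>: "\<And>j. j \<in> J \<Longrightarrow> \<theta> j \<in> V"
      "\<And>i j. i \<in> J \<Longrightarrow> j \<in> J \<Longrightarrow> \<theta> j i = (if i = j then s else \<zero>)"
    using Q unfolding Q_def by auto
  have "\<iota> (s \<otimes> c) \<otimes>\<^bsub>E\<^esub> \<xi> = \<zero>\<^bsub>E\<^esub>" if \<xi>: "\<xi> \<in> V" and van: "\<And>j. j \<in> J \<Longrightarrow> \<xi> j = \<zero>" for \<xi>
  proof (rule det)
    show "\<iota> (s \<otimes> c) \<otimes>\<^bsub>E\<^esub> \<xi> \<in> V" using V(2) \<xi> s c by simp
    fix b assume b: "b \<in> B"
    have bR: "b \<in> carrier R" using b B by blast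
    have \<xi>E: "\<xi> \<in> carrier E" using \<xi> V(1) by blast
    define t where "t = \<xi> b"
    have t: "t \<in> carrier R" using E_closed[OF \<xi>E bR] t_def by simp
    have "s \<otimes> c \<otimes> t = \<zero>"
    proof (rule ccontr)
      \<comment> \<open>A nonzero s c t makes t usable as a pivot: b can then be added to J with new
        factor s t, against maximality.\<close>
      assume ne: "s \<otimes> c \<otimes> t \<noteq> \<zero>"
      have bJ: "b \<notin> J"
      proof
        assume "b \<in> J"
        then have "t = \<zero>" using van t_def by simp
        then show False using ne s c by simp
      qed
      \<comment> \<open>Cross-multiplication in place of division. The new operator s \<xi> is s t
        at b and zero on J; subtracting a multiple of \<xi> clears the value of each old operator at
        b and scales its diagonal entry from s to s t.\<close>
      define \<theta>' where "\<theta>' j = (if j = b then \<iota> s \<otimes>\<^bsub>E\<^esub> \<xi> else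
        \<iota> t \<otimes>\<^bsub>E\<^esub> \<theta> j \<ominus>\<^bsub>E\<^esub> \<iota> (\<theta> j b) \<otimes>\<^bsub>E\<^esub> \<xi>)" for j
      have \<theta>E: "\<theta> j \<in> carrier E" "\<theta> j b \<in> carrier R" if "j \<in> J" for j
        using \<theta>(1)[OF that] V(1) E_closed bR by auto
      have "Q (insert b J) (s \<otimes> t) \<theta>'"
        unfolding Q_def
      proof (intro conjI ballI)
        show "s \<otimes> t \<in> carrier R" using s t by simp
        show "s \<otimes> t \<otimes> c \<noteq> \<zero>" using ne s t c by (simp add: m_assoc m_comm[of t c])
        show "\<theta>' j \<in> V" if "j \<in> insert b J" for j
          using that V(2,3) \<theta>(1) \<xi> s t \<theta>E unfolding \<theta>'_def by auto
        fix i j assume i: "i \<in> insert b J" and j: "j \<in> insert b J"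
        have iR: "i \<in> carrier R" using i bR JB B by blast
        have v: "\<xi> i = (if i = b then t else \<zero>)" using i van t_def by auto
        show "\<theta>' j i = (if i = j then s \<otimes> t else \<zero>)"
        proof (cases "j = b")
          case True
          then show ?thesis using iR v s t by (simp add: \<theta>'_def)
        next
          case False
          then have jJ: "j \<in> J" using j by blast
          have "\<theta>' j i = t \<otimes> \<theta> j i \<ominus> \<theta> j b \<otimes> \<xi> i"
            using False iR t \<xi>E \<theta>E[OF jJ] E_closed by (simp add: \<theta>'_def)
          also have "\<dots> = (if i = j then s \<otimes> t else \<zero>)"
          proof (cases "i = b")
            case True
            then show ?thesis using False v t \<theta>E[OF jJ] by (simp add: m_comm)
          next
            case b: False
            then have "i \<in> J" using i by blast
            then show ?thesis using \<theta>(2)[OF _ jJ] b v t s \<theta>E[OF jJ] by (simp add: m_comm minus_eq)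
          qed
          finally show ?thesis .
        qed
      qed
      then have "insert b J \<in> ?S" using JB b by blast
      then have "J = insert b J" using max by blast
      then show False using bJ by blast
    qed
    then show "(\<iota> (s \<otimes> c) \<otimes>\<^bsub>E\<^esub> \<xi>) b = \<zero>"
      using bR t s c E_closed[OF \<xi>E bR] unfolding t_def by simp
  qed
  then show thesis using that JB s \<theta> by blast
qed

text \<open>For positive n, the n-th power of a b is a multiple of a^n b, so a b is
  nilpotent.\<close>

lemma reduced_cancel:
  assumes "reduced_ring R" "a \<in> carrier R" "b \<in> carrier R" "a [^] (n::nat) \<otimes> b = \<zero>"
  shows "a \<otimes> b = \<zero>"
proof (cases n)
  case 0
  then show ?thesis using assms by simp
next
  case (Suc m)
  have "(a \<otimes> b) [^] n = a [^] n \<otimes> b \<otimes> b [^] m"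
    using assms(2,3) unfolding Suc nat_pow_distrib[OF assms(2,3)]
    by (simp add: m_ac)
  also have "\<dots> = \<zero>" using assms by simp
  finally show ?thesis using assms unfolding reduced_ring_def by blast
qed

section \<open>Operators commuting with powers\<close>

definition power_linear :: "nat \<Rightarrow> ('a \<Rightarrow> 'a) set" where
  "power_linear q = {\<xi> \<in> D. \<forall>f\<in>carrier R. ad (f [^] q) \<xi> = \<zero>\<^bsub>E\<^esub>}"

lemma power_linear_D: "\<xi> \<in> power_linear q \<Longrightarrow> \<xi> \<in> D"
  by (simp add: power_linear_def)

lemma power_linear_apply:
  assumes "\<xi> \<in> power_linear q" "f \<in> carrier R" "x \<in> carrier R"
  shows "\<xi> (f [^] q \<otimes> x) = f [^] q \<otimes> \<xi> x"
proof -
  have \<xi>: "\<xi> \<in> carrier E" using assms(1) power_linear_D by blast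
  have "ad (f [^] q) \<xi> x = \<zero>" using assms unfolding power_linear_def by simp
  then show ?thesis using assms(2,3) E_closed[OF \<xi>] ad_apply[OF _ \<xi>, of "f [^] q" x] r_right_minus_eq
    by simp
qed

lemma power_linear_\<iota>: "f \<in> carrier R \<Longrightarrow> \<iota> f \<in> power_linear q"
  by (auto simp: power_linear_def ad_\<iota>)

lemma power_linear_mult:
  "\<xi> \<in> power_linear q \<Longrightarrow> \<eta> \<in> power_linear q \<Longrightarrow> \<xi> \<otimes>\<^bsub>E\<^esub> \<eta> \<in> power_linear q"
  by (auto simp: power_linear_def ad_mult)

lemma power_linear_minus:
  "\<xi> \<in> power_linear q \<Longrightarrow> \<eta> \<in> power_linear q \<Longrightarrow> \<xi> \<ominus>\<^bsub>E\<^esub> \<eta> \<in> power_linear q"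
  by (simp add: power_linear_def ad_minus_op D_minus)

lemma power_linear_add:
  "\<xi> \<in> power_linear q \<Longrightarrow> \<eta> \<in> power_linear q \<Longrightarrow> \<xi> \<oplus>\<^bsub>E\<^esub> \<eta> \<in> power_linear q"
  by (auto simp: power_linear_def ad_add)

end

context anti_automorphism
begin

text \<open>By \<open>\<Phi>_ad\<close>, a vanishing commutator with a function stays zero under
  \<open>\<Phi>\<close>.\<close>

lemma power_linear_\<Phi>: "\<xi> \<in> power_linear q \<Longrightarrow> \<Phi> \<xi> \<in> power_linear q"
proof -
  assume a: "\<xi> \<in> power_linear q"
  then have \<xi>: "\<xi> \<in> D" by (rule power_linear_D)
  have "ad (f [^] q) (\<Phi> \<xi>) = \<zero>\<^bsub>E\<^esub>" if f: "f \<in> carrier R" for f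
  proof -
    have fq: "f [^] q \<in> carrier R" using f by simp
    have "ad (f [^] q) \<xi> = \<zero>\<^bsub>E\<^esub>" using a f unfolding power_linear_def by blast
    then have "\<ominus>\<^bsub>E\<^esub> ad (f [^] q) (\<Phi> \<xi>) = \<zero>\<^bsub>E\<^esub>" using \<Phi>_ad[OF fq \<xi>] \<Phi>_zero by simp
    then show ?thesis using fq \<xi> by (metis E.minus_minus E.minus_zero D_E \<Phi>_D ad_closed)
  qed
  then show ?thesis using \<xi> by (simp add: power_linear_def)
qed

text \<open>An operator \<open>\<theta>\<close> whose values are central behaves like a rank one operator, and \<open>\<Phi> \<theta>\<close> is
  then intertwined with \<open>\<theta>\<close> by every element in its image.\<close>

lemma \<Phi>\<Phi>_rank_one:
  assumes red: "reduced_ring R" and q: "0 < q"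
    and \<theta>: "\<theta> \<in> power_linear q"
    and central: "\<And>\<xi> a x. \<xi> \<in> power_linear q \<Longrightarrow> a \<in> carrier R \<Longrightarrow> x \<in> carrier R \<Longrightarrow>
      \<xi> (a \<otimes> \<theta> x) = \<xi> a \<otimes> \<theta> x"
    and x: "x \<in> carrier R" and b: "b \<in> carrier R"
  shows "(\<Phi> (\<Phi> \<theta>) x \<ominus> \<theta> x) \<otimes> \<theta> b = \<zero>"
proof -
  define \<tau> where "\<tau> = \<Phi> \<theta>"
  have \<theta>D: "\<theta> \<in> D" using \<theta> by (rule power_linear_D)
  have \<tau>: "\<tau> \<in> power_linear q" unfolding \<tau>_def using \<theta> by (rule power_linear_\<Phi>)
  have \<tau>D: "\<tau> \<in> D" using \<tau> by (rule power_linear_D)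
  note cl = E_closed[OF D_E[OF \<theta>D]] E_closed[OF D_E[OF \<tau>D]] E_closed[OF D_E[OF \<Phi>_D[OF \<tau>D]]]
  have 1: "\<tau> (a \<otimes> \<tau> y) = \<tau> y \<otimes> \<theta> a" if a: "a \<in> carrier R" and y: "y \<in> carrier R" for a y
  proof -
    \<comment> \<open>This is the rank one identity, obtained from \<open>central\<close> with
      \<theta> itself as the outer operator.\<close>
    have "\<theta> \<otimes>\<^bsub>E\<^esub> (\<iota> a \<otimes>\<^bsub>E\<^esub> \<theta>) = \<iota> (\<theta> a) \<otimes>\<^bsub>E\<^esub> \<theta>"
      by (rule E_eqI) (use a \<theta>D cl central[OF \<theta> a] in auto)
    then have "\<Phi> (\<theta> \<otimes>\<^bsub>E\<^esub> (\<iota> a \<otimes>\<^bsub>E\<^esub> \<theta>)) = \<Phi> (\<iota> (\<theta> a) \<otimes>\<^bsub>E\<^esub> \<theta>)" by simp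
    then have "\<tau> \<otimes>\<^bsub>E\<^esub> \<iota> a \<otimes>\<^bsub>E\<^esub> \<tau> = \<tau> \<otimes>\<^bsub>E\<^esub> \<iota> (\<theta> a)"
      using a \<theta>D cl by (simp add: \<Phi>_mult D_\<iota> D_mult \<Phi>_\<iota> \<tau>_def)
    then have "(\<tau> \<otimes>\<^bsub>E\<^esub> \<iota> a \<otimes>\<^bsub>E\<^esub> \<tau>) y = (\<tau> \<otimes>\<^bsub>E\<^esub> \<iota> (\<theta> a)) y" by simp
    then have "\<tau> (a \<otimes> \<tau> y) = \<tau> (\<theta> a \<otimes> y)" using a y cl by simp
    \<comment> \<open>Now \<open>central\<close> is applied with \<tau> as the outer operator, which
      is allowed since \<open>\<Phi>\<close> preserves \<open>power_linear q\<close>.\<close>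
    also have "\<dots> = \<tau> y \<otimes> \<theta> a" using central[OF \<tau> y a] a y cl by (simp add: m_comm)
    finally show ?thesis .
  qed
  have 2: "\<tau> y \<otimes> (\<Phi> \<tau> x \<ominus> \<theta> x) = \<zero>" if y: "y \<in> carrier R" for y
  proof -
    have w: "\<tau> y \<in> carrier R" using cl y by simp
    \<comment> \<open>With w = \<tau>(y), fact 1 reads \<tau> w = w \<theta>. Under
      \<open>\<Phi>\<close> the left side becomes w \<open>\<Phi> \<tau>\<close>, and the right side
      becomes \<tau> w, which is w \<theta> again.\<close>
    have "\<tau> \<otimes>\<^bsub>E\<^esub> \<iota> (\<tau> y) = \<iota> (\<tau> y) \<otimes>\<^bsub>E\<^esub> \<theta>"
      by (rule E_eqI) (use w \<theta>D \<tau>D 1[OF _ y] cl in \<open>auto simp: m_comm\<close>)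
    moreover have "\<Phi> (\<tau> \<otimes>\<^bsub>E\<^esub> \<iota> (\<tau> y)) = \<iota> (\<tau> y) \<otimes>\<^bsub>E\<^esub> \<Phi> \<tau>"
      using w \<tau>D by (simp add: \<Phi>_mult D_\<iota> \<Phi>_\<iota>)
    moreover have "\<Phi> (\<iota> (\<tau> y) \<otimes>\<^bsub>E\<^esub> \<theta>) = \<tau> \<otimes>\<^bsub>E\<^esub> \<iota> (\<tau> y)"
      using w \<theta>D by (simp add: \<Phi>_mult D_\<iota> \<Phi>_\<iota> \<tau>_def[symmetric])
    ultimately have "(\<iota> (\<tau> y) \<otimes>\<^bsub>E\<^esub> \<Phi> \<tau>) x = (\<iota> (\<tau> y) \<otimes>\<^bsub>E\<^esub> \<theta>) x" by simp
    then have "\<tau> y \<otimes> \<Phi> \<tau> x = \<tau> y \<otimes> \<theta> x" using x cl by simp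
    then show ?thesis using w x cl by (simp add: minus_eq r_distr r_minus r_neg)
  qed
  define g where "g = \<Phi> \<tau> x \<ominus> \<theta> x"
  have g: "g \<in> carrier R" using cl x by (simp add: g_def)
  \<comment> \<open>By fact 2, g annihilates the image of \<tau>. Injectivity of
    \<open>\<Phi>\<close> turns g \<tau> = 0 into \<theta> g = 0.\<close>
  have "\<Phi> (\<theta> \<otimes>\<^bsub>E\<^esub> \<iota> g) = \<iota> g \<otimes>\<^bsub>E\<^esub> \<tau>"
    using g \<theta>D by (simp add: \<Phi>_mult D_\<iota> \<Phi>_\<iota> \<tau>_def)
  also have "\<dots> = \<zero>\<^bsub>E\<^esub>"
    by (rule E_eqI) (use g \<tau>D cl 2 in \<open>auto simp: g_def[symmetric] m_comm[of g]\<close>)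
  finally have "\<theta> \<otimes>\<^bsub>E\<^esub> \<iota> g = \<zero>\<^bsub>E\<^esub>"
    using \<Phi>_inj[of "\<theta> \<otimes>\<^bsub>E\<^esub> \<iota> g" "\<zero>\<^bsub>E\<^esub>"] \<Phi>_zero g \<theta>D D_\<iota> D_mult D_zero by simp
  \<comment> \<open>The argument is chosen to complete g to the power g^q, which can be pulled out
    of \<theta>.\<close>
  then have "(\<theta> \<otimes>\<^bsub>E\<^esub> \<iota> g) (g [^] (q - 1) \<otimes> b) = \<zero>" using g b by simp
  then have "\<theta> (g \<otimes> (g [^] (q - 1) \<otimes> b)) = \<zero>" using g b by simp
  moreover have "g \<otimes> (g [^] (q - 1) \<otimes> b) = g [^] q \<otimes> b"
  proof -
    obtain r where "q = Suc r" using q by (cases q) auto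
    then show ?thesis using g b by (simp add: m_ac)
  qed
  ultimately have "g [^] q \<otimes> \<theta> b = \<zero>" using power_linear_apply[OF \<theta> g b] by simp
  then have "g \<otimes> \<theta> b = \<zero>" using reduced_cancel[OF red g] cl b by blast
  then show ?thesis unfolding g_def \<tau>_def .
qed

theorem \<Phi>\<Phi>_torsion:
  assumes red: "reduced_ring R" and q: "0 < q"
    and B: "finite B" "B \<subseteq> carrier R"
    and det: "\<And>\<xi>. \<xi> \<in> power_linear q \<Longrightarrow> (\<And>b. b \<in> B \<Longrightarrow> \<xi> b = \<zero>) \<Longrightarrow> \<xi> = \<zero>\<^bsub>E\<^esub>"
    and \<xi>: "\<xi> \<in> power_linear q"
  shows "\<Phi> (\<Phi> \<xi>) = \<xi>"
proof (rule ccontr)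
  assume neq: "\<Phi> (\<Phi> \<xi>) \<noteq> \<xi>"
  have \<xi>D: "\<xi> \<in> D" using \<xi> by (rule power_linear_D)
  have cl: "\<eta> x \<in> carrier R" "\<Phi> (\<Phi> \<eta>) x \<in> carrier R" if "\<eta> \<in> D" "x \<in> carrier R" for \<eta> x
    using that E_closed[OF D_E] by auto
  obtain x\<^sub>0 where x\<^sub>0: "x\<^sub>0 \<in> carrier R" and "\<Phi> (\<Phi> \<xi>) x\<^sub>0 \<noteq> \<xi> x\<^sub>0"
    using neq E_eqI[of "\<Phi> (\<Phi> \<xi>)" \<xi>] \<xi>D by auto
  define c where "c = \<Phi> (\<Phi> \<xi>) x\<^sub>0 \<ominus> \<xi> x\<^sub>0"
  have c: "c \<in> carrier R" "c \<noteq> \<zero>"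
    using cl[OF \<xi>D x\<^sub>0] \<open>\<Phi> (\<Phi> \<xi>) x\<^sub>0 \<noteq> \<xi> x\<^sub>0\<close> by (simp_all add: c_def)
  have cq: "c [^] q \<in> carrier R" "c [^] q \<noteq> \<zero>"
    using c red unfolding reduced_ring_def by auto
  obtain J s \<theta> where J: "J \<subseteq> B" and s: "s \<in> carrier R" "s \<otimes> c [^] q \<noteq> \<zero>"
    and \<theta>: "\<And>j. j \<in> J \<Longrightarrow> \<theta> j \<in> power_linear q"
      "\<And>i j. i \<in> J \<Longrightarrow> j \<in> J \<Longrightarrow> \<theta> j i = (if i = j then s else \<zero>)"
    and van: "\<And>\<xi>. \<xi> \<in> power_linear q \<Longrightarrow> (\<And>j. j \<in> J \<Longrightarrow> \<xi> j = \<zero>) \<Longrightarrow> \<iota> (s \<otimes> c [^] q) \<otimes>\<^bsub>E\<^esub> \<xi> = \<zero>\<^bsub>E\<^esub>"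
    by (rule elimination[OF _ power_linear_mult[OF power_linear_\<iota>] power_linear_minus B det cq])
      (use power_linear_D in blast)+
  \<comment> \<open>The scalars \<mu> and \<sigma> are q-th powers, so every power-linear operator
    commutes with them.\<close>
  define u where "u = s \<otimes> c [^] q"
  define \<mu> where "\<mu> = u [^] q"
  define \<sigma> where "\<sigma> = s [^] q"
  have u: "u \<in> carrier R" "u \<noteq> \<zero>" and \<mu>: "\<mu> \<in> carrier R" and \<sigma>: "\<sigma> \<in> carrier R"
    using s cq by (auto simp: u_def \<mu>_def \<sigma>_def)
  have JR: "j \<in> carrier R" if "j \<in> J" for j using that J B by blast
  obtain r where r: "q = Suc r" using q by (cases q) auto
  have van': "\<mu> \<otimes> \<eta> x = \<zero>"
    if \<eta>: "\<eta> \<in> power_linear q" and v: "\<And>j. j \<in> J \<Longrightarrow> \<eta> j = \<zero>" and x: "x \<in> carrier R" for \<eta> x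
  proof -
    have "(\<iota> u \<otimes>\<^bsub>E\<^esub> \<eta>) x = \<zero>" using van[OF \<eta> v] x unfolding u_def by simp
    then have "u \<otimes> \<eta> x = \<zero>" using x u cl[OF power_linear_D[OF \<eta>]] by simp
    moreover have "\<mu> \<otimes> \<eta> x = u [^] r \<otimes> (u \<otimes> \<eta> x)"
      using x u cl[OF power_linear_D[OF \<eta>]] by (simp add: \<mu>_def r m_assoc)
    ultimately show ?thesis using u by simp
  qed
  \<comment> \<open>The extra s^(q-1) turns the diagonal values s into the q-th power
    \<sigma>.\<close>
  define \<theta>' where "\<theta>' j = \<iota> (s [^] r) \<otimes>\<^bsub>E\<^esub> \<theta> j" for j
  have \<theta>': "\<theta>' j \<in> power_linear q" if "j \<in> J" for j
    unfolding \<theta>'_def using that s \<theta>(1) by (simp add: power_linear_mult power_linear_\<iota>)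
  have \<theta>'_val: "\<theta>' j i = (if i = j then \<sigma> else \<zero>)" if "i \<in> J" "j \<in> J" for i j
    using \<theta>(2)[OF that] JR[OF that(1)] s by (simp add: \<theta>'_def \<sigma>_def r)
  \<comment> \<open>The difference of the two sides, taken without \<mu>, is an operator in x that
    vanishes on J: off the diagonal trivially, on it because \<sigma> passes through \<eta>. Hence
    \<mu> annihilates it.\<close>
  have central: "\<eta> (a \<otimes> (\<iota> \<mu> \<otimes>\<^bsub>E\<^esub> \<theta>' i) x) = \<eta> a \<otimes> (\<iota> \<mu> \<otimes>\<^bsub>E\<^esub> \<theta>' i) x"
    if \<eta>: "\<eta> \<in> power_linear q" and a: "a \<in> carrier R" and x: "x \<in> carrier R" and i: "i \<in> J" for \<eta> a x i
  proof -
    note \<eta>D = power_linear_D[OF \<eta>] and \<theta>D = power_linear_D[OF \<theta>'[OF i]]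
    have \<theta>x: "\<theta>' i x \<in> carrier R" using cl(1)[OF \<theta>D x] .
    have \<eta>a: "\<eta> a \<in> carrier R" using cl(1)[OF \<eta>D a] .
    have \<eta>ax: "\<eta> (a \<otimes> \<theta>' i x) \<in> carrier R" using cl(1)[OF \<eta>D] a \<theta>x by simp
    let ?\<zeta> = "\<eta> \<otimes>\<^bsub>E\<^esub> (\<iota> a \<otimes>\<^bsub>E\<^esub> \<theta>' i) \<ominus>\<^bsub>E\<^esub> \<iota> (\<eta> a) \<otimes>\<^bsub>E\<^esub> \<theta>' i"
    have \<zeta>: "?\<zeta> \<in> power_linear q"
      using \<eta> a \<theta>'[OF i] \<eta>a by (intro power_linear_minus power_linear_mult power_linear_\<iota>)
    have ap: "?\<zeta> y = \<eta> (a \<otimes> \<theta>' i y) \<ominus> \<eta> a \<otimes> \<theta>' i y" if "y \<in> carrier R" for y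
      using that \<eta>D \<theta>D a \<eta>a cl(1)[OF \<theta>D] by simp
    have "?\<zeta> j = \<zero>" if j: "j \<in> J" for j
    proof (cases "j = i")
      case True
      have "\<eta> (a \<otimes> \<sigma>) = \<eta> a \<otimes> \<sigma>"
        using power_linear_apply[OF \<eta> s(1) a] a \<eta>a \<sigma> by (simp add: \<sigma>_def m_comm)
      then show ?thesis using True \<theta>'_val[OF j i] ap[OF JR[OF j]] \<eta>a \<sigma> by simp
    next
      case False
      then show ?thesis using \<theta>'_val[OF j i] ap[OF JR[OF j]] \<eta>a a \<eta>D by simp
    qed
    then have "\<mu> \<otimes> ?\<zeta> x = \<zero>" using van'[OF \<zeta> _ x] by blast
    then have "\<mu> \<otimes> \<eta> (a \<otimes> \<theta>' i x) \<ominus> \<mu> \<otimes> (\<eta> a \<otimes> \<theta>' i x) = \<zero>"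
      using ap[OF x] \<mu> \<eta>ax \<eta>a \<theta>x by (simp add: minus_eq r_distr r_minus)
    then have "\<mu> \<otimes> \<eta> (a \<otimes> \<theta>' i x) = \<mu> \<otimes> (\<eta> a \<otimes> \<theta>' i x)"
      using \<mu> \<eta>ax \<eta>a \<theta>x by simp
    \<comment> \<open>As a q-th power, \<mu> can be moved inside \<eta> and absorbed into the rank
      one operator.\<close>
    moreover have "\<eta> (\<mu> \<otimes> (a \<otimes> \<theta>' i x)) = \<mu> \<otimes> \<eta> (a \<otimes> \<theta>' i x)"
      unfolding \<mu>_def using power_linear_apply[OF \<eta> u(1)] a \<theta>x by simp
    ultimately show ?thesis using x a \<mu> \<theta>x \<eta>a by (simp add: m_lcomm[of a \<mu>] m_lcomm[of "\<eta> a" \<mu>])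
  qed
  let ?K = "\<mu> \<otimes> (\<mu> \<otimes> \<sigma>)"
  have K: "?K \<in> carrier R" using \<mu> \<sigma> by simp
  define W where "W = {\<eta> \<in> power_linear q. \<forall>x\<in>carrier R. ?K \<otimes> (\<Phi> (\<Phi> \<eta>) x \<ominus> \<eta> x) = \<zero>}"
  have W_mult: "\<iota> a \<otimes>\<^bsub>E\<^esub> \<eta> \<in> W" if a: "a \<in> carrier R" and \<eta>: "\<eta> \<in> W" for a \<eta>
  proof -
    have \<eta>p: "\<eta> \<in> power_linear q" and h: "\<And>x. x \<in> carrier R \<Longrightarrow> ?K \<otimes> (\<Phi> (\<Phi> \<eta>) x \<ominus> \<eta> x) = \<zero>"
      using \<eta> unfolding W_def by auto
    have \<eta>D: "\<eta> \<in> D" using \<eta>p by (rule power_linear_D)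
    have "\<Phi> (\<Phi> (\<iota> a \<otimes>\<^bsub>E\<^esub> \<eta>)) = \<iota> a \<otimes>\<^bsub>E\<^esub> \<Phi> (\<Phi> \<eta>)"
      using a \<eta>D by (simp add: \<Phi>_mult D_\<iota> \<Phi>_\<iota>)
    moreover have "?K \<otimes> (a \<otimes> \<Phi> (\<Phi> \<eta>) x \<ominus> a \<otimes> \<eta> x) = a \<otimes> (?K \<otimes> (\<Phi> (\<Phi> \<eta>) x \<ominus> \<eta> x))"
      if x: "x \<in> carrier R" for x
      using a K cl[OF \<eta>D x] by algebra
    ultimately show ?thesis unfolding W_def using a \<eta>p h cl[OF \<eta>D]
      by (simp add: power_linear_mult power_linear_\<iota>)
  qed
  have W_add: "\<eta> \<oplus>\<^bsub>E\<^esub> \<zeta> \<in> W" if \<eta>: "\<eta> \<in> W" and \<zeta>: "\<zeta> \<in> W" for \<eta> \<zeta>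
  proof -
    have p: "\<eta> \<in> power_linear q" "\<zeta> \<in> power_linear q" using \<eta> \<zeta> unfolding W_def by auto
    note d = power_linear_D[OF p(1)] power_linear_D[OF p(2)]
    have "?K \<otimes> ((\<Phi> (\<Phi> \<eta>) x \<oplus> \<Phi> (\<Phi> \<zeta>) x) \<ominus> (\<eta> x \<oplus> \<zeta> x)) =
      ?K \<otimes> (\<Phi> (\<Phi> \<eta>) x \<ominus> \<eta> x) \<oplus> ?K \<otimes> (\<Phi> (\<Phi> \<zeta>) x \<ominus> \<zeta> x)" if x: "x \<in> carrier R" for x
      using K cl[OF d(1) x] cl[OF d(2) x] by algebra
    then show ?thesis using p \<eta> \<zeta> d unfolding W_def by (simp add: power_linear_add \<Phi>_add)
  qed
  have W_\<theta>: "\<theta>' i \<in> W" if i: "i \<in> J" for i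
  proof -
    note \<theta>D = power_linear_D[OF \<theta>'[OF i]]
    have "?K \<otimes> (\<Phi> (\<Phi> (\<theta>' i)) x \<ominus> \<theta>' i x) = \<zero>" if x: "x \<in> carrier R" for x
    proof -
      have "(\<Phi> (\<Phi> (\<iota> \<mu> \<otimes>\<^bsub>E\<^esub> \<theta>' i)) x \<ominus> (\<iota> \<mu> \<otimes>\<^bsub>E\<^esub> \<theta>' i) x) \<otimes> (\<iota> \<mu> \<otimes>\<^bsub>E\<^esub> \<theta>' i) i = \<zero>"
        using \<theta>'[OF i] \<mu> x JR[OF i] i central
        by (intro \<Phi>\<Phi>_rank_one[OF red q]) (auto intro: power_linear_mult power_linear_\<iota>)
      then have "(\<mu> \<otimes> \<Phi> (\<Phi> (\<theta>' i)) x \<ominus> \<mu> \<otimes> \<theta>' i x) \<otimes> (\<mu> \<otimes> \<sigma>) = \<zero>"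
        using x JR[OF i] \<theta>'_val[OF i i] \<theta>D \<mu> \<sigma> cl[OF \<theta>D x]
        by (simp add: \<Phi>_mult D_\<iota> \<Phi>_\<iota>)
      moreover have "?K \<otimes> (\<Phi> (\<Phi> (\<theta>' i)) x \<ominus> \<theta>' i x) = (\<mu> \<otimes> \<Phi> (\<Phi> (\<theta>' i)) x \<ominus> \<mu> \<otimes> \<theta>' i x) \<otimes> (\<mu> \<otimes> \<sigma>)"
        using \<mu> \<sigma> cl[OF \<theta>D x] by algebra
      ultimately show ?thesis by simp
    qed
    then show ?thesis using \<theta>'[OF i] by (simp add: W_def)
  qed
  have "\<zero>\<^bsub>E\<^esub> \<in> W" unfolding W_def using K power_linear_\<iota>[OF zero_closed]
    by (simp add: \<Phi>_zero \<iota>_zero minus_eq)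
  have "finite J" using J B finite_subset by blast
  \<comment> \<open>The witness is the sum of \<xi>(j) \<theta>'_j over J'. Adding one term at a
    time keeps it in W, and only its values on J matter.\<close>
  have "J' \<subseteq> J \<Longrightarrow> \<exists>\<omega>\<in>W. \<forall>j\<in>J. \<omega> j = (if j \<in> J' then \<sigma> \<otimes> \<xi> j else \<zero>)" if "finite J'" for J'
    using that(1)
  proof (induction J' rule: finite_induct)
    case empty
    then show ?case using \<open>\<zero>\<^bsub>E\<^esub> \<in> W\<close> JR by (intro bexI[of _ "\<zero>\<^bsub>E\<^esub>"]) auto
  next
    case (insert i J')
    then obtain \<omega> where \<omega>: "\<omega> \<in> W" "\<And>j. j \<in> J \<Longrightarrow> \<omega> j = (if j \<in> J' then \<sigma> \<otimes> \<xi> j else \<zero>)" by auto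
    have i: "i \<in> J" using insert by blast
    have "(\<omega> \<oplus>\<^bsub>E\<^esub> \<iota> (\<xi> i) \<otimes>\<^bsub>E\<^esub> \<theta>' i) j = (if j \<in> insert i J' then \<sigma> \<otimes> \<xi> j else \<zero>)" if j: "j \<in> J" for j
      using \<omega>(2)[OF j] \<theta>'_val[OF j i] JR[OF j] JR[OF i] insert.hyps \<sigma> cl(1)[OF \<xi>D]
      by (auto simp: m_comm)
    moreover have "\<omega> \<oplus>\<^bsub>E\<^esub> \<iota> (\<xi> i) \<otimes>\<^bsub>E\<^esub> \<theta>' i \<in> W"
      using W_add[OF \<omega>(1) W_mult[OF _ W_\<theta>[OF i]]] cl(1)[OF \<xi>D JR[OF i]] by blast
    ultimately show ?case by blast
  qed
  from this[OF \<open>finite J\<close> order_refl] obtain \<omega> where \<omega>: "\<omega> \<in> W" "\<And>j. j \<in> J \<Longrightarrow> \<omega> j = \<sigma> \<otimes> \<xi> j"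
    by auto
  have \<omega>p: "\<omega> \<in> power_linear q" using \<omega>(1) unfolding W_def by blast
  note \<omega>D = power_linear_D[OF \<omega>p]
  \<comment> \<open>The operators \<sigma> \<xi> and \<omega> agree on J, so \<mu> annihilates their
    difference.\<close>
  have "\<iota> (\<mu> \<otimes> \<sigma>) \<otimes>\<^bsub>E\<^esub> \<xi> = \<iota> \<mu> \<otimes>\<^bsub>E\<^esub> \<omega>"
  proof (rule E_eqI)
    fix x assume x: "x \<in> carrier R"
    let ?\<zeta> = "\<iota> \<sigma> \<otimes>\<^bsub>E\<^esub> \<xi> \<ominus>\<^bsub>E\<^esub> \<omega>"
    have ap: "?\<zeta> y = \<sigma> \<otimes> \<xi> y \<ominus> \<omega> y" if "y \<in> carrier R" for y
      using that \<sigma> \<xi>D \<omega>D cl(1)[OF \<xi>D] by simp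
    have "\<mu> \<otimes> ?\<zeta> x = \<zero>"
    proof (rule van'[OF _ _ x])
      show "?\<zeta> \<in> power_linear q" using \<xi> \<omega>p \<sigma> by (intro power_linear_minus power_linear_mult power_linear_\<iota>)
      show "?\<zeta> j = \<zero>" if "j \<in> J" for j
        using ap[OF JR[OF that]] \<omega>(2)[OF that] \<sigma> cl(1)[OF \<xi>D JR[OF that]] by simp
    qed
    then have "\<mu> \<otimes> (\<sigma> \<otimes> \<xi> x) \<ominus> \<mu> \<otimes> \<omega> x = \<zero>"
      using ap[OF x] \<mu> \<sigma> cl(1)[OF \<xi>D x] cl(1)[OF \<omega>D x] by (simp add: minus_eq r_distr r_minus)
    then show "(\<iota> (\<mu> \<otimes> \<sigma>) \<otimes>\<^bsub>E\<^esub> \<xi>) x = (\<iota> \<mu> \<otimes>\<^bsub>E\<^esub> \<omega>) x"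
      using x \<mu> \<sigma> cl(1)[OF \<xi>D x] cl(1)[OF \<omega>D x] by (simp add: m_assoc)
  qed (use \<mu> \<sigma> \<xi>D \<omega>D in auto)
  then have "\<iota> (\<mu> \<otimes> \<sigma>) \<otimes>\<^bsub>E\<^esub> \<xi> \<in> W" using W_mult[OF \<mu> \<omega>(1)] by simp
  then have "?K \<otimes> (\<Phi> (\<Phi> (\<iota> (\<mu> \<otimes> \<sigma>) \<otimes>\<^bsub>E\<^esub> \<xi>)) x\<^sub>0 \<ominus> (\<iota> (\<mu> \<otimes> \<sigma>) \<otimes>\<^bsub>E\<^esub> \<xi>) x\<^sub>0) = \<zero>"
    using x\<^sub>0 unfolding W_def by blast
  then have 1: "?K \<otimes> ((\<mu> \<otimes> \<sigma>) \<otimes> \<Phi> (\<Phi> \<xi>) x\<^sub>0 \<ominus> (\<mu> \<otimes> \<sigma>) \<otimes> \<xi> x\<^sub>0) = \<zero>"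
    using x\<^sub>0 \<mu> \<sigma> \<xi>D cl[OF \<xi>D x\<^sub>0] by (simp add: \<Phi>_mult D_\<iota> \<Phi>_\<iota>)
  have "?K \<otimes> ((\<mu> \<otimes> \<sigma>) \<otimes> \<Phi> (\<Phi> \<xi>) x\<^sub>0 \<ominus> (\<mu> \<otimes> \<sigma>) \<otimes> \<xi> x\<^sub>0) = (\<mu> \<otimes> \<mu> \<otimes> \<mu> \<otimes> \<sigma> \<otimes> \<sigma>) \<otimes> c"
    unfolding c_def using \<mu> \<sigma> cl[OF \<xi>D x\<^sub>0] by algebra
  \<comment> \<open>All accumulated factors form a single q-th power, so reducedness removes the
    exponent.\<close>
  also have "\<mu> \<otimes> \<mu> \<otimes> \<mu> \<otimes> \<sigma> \<otimes> \<sigma> = (u \<otimes> u \<otimes> u \<otimes> s \<otimes> s) [^] q"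
    using u s by (simp add: \<mu>_def \<sigma>_def nat_pow_distrib)
  finally have "(u \<otimes> u \<otimes> u \<otimes> s \<otimes> s) [^] q \<otimes> c = \<zero>" using 1 by simp
  then have "u \<otimes> u \<otimes> u \<otimes> s \<otimes> s \<otimes> c = \<zero>"
    using reduced_cancel[OF red _ c(1), of "u \<otimes> u \<otimes> u \<otimes> s \<otimes> s" q] u s by simp
  \<comment> \<open>The added powers of c complete s s c to (s c^q)^2 = u^2, making the whole
    product u^5.\<close>
  then have "(u \<otimes> u \<otimes> u \<otimes> s \<otimes> s \<otimes> c) \<otimes> (c [^] r \<otimes> c [^] q) = \<zero>" using c by simp
  moreover have "(u \<otimes> u \<otimes> u \<otimes> s \<otimes> s \<otimes> c) \<otimes> (c [^] r \<otimes> c [^] q) = u [^] (5::nat)"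
  proof -
    have "c \<otimes> c [^] r = c [^] q" using c unfolding r by (simp add: m_comm)
    moreover have "(u \<otimes> u \<otimes> u \<otimes> s \<otimes> s \<otimes> c) \<otimes> (c [^] r \<otimes> c [^] q)
      = u \<otimes> u \<otimes> u \<otimes> (s \<otimes> (c \<otimes> c [^] r)) \<otimes> (s \<otimes> c [^] q)"
      using u s c by (simp add: m_ac)
    ultimately show ?thesis using u(1) by (simp add: u_def[symmetric] numeral_eq_Suc)
  qed
  ultimately show False using u red unfolding reduced_ring_def by auto
qed

end

section \<open>Derivations and Euler's identity\<close>

context algebra_operators
begin

text \<open>These are the k-derivations of R: \<open>derivation_mult\<close> recovers the Leibniz
  rule from order at most one and the vanishing at 1.\<close>

definition derivations :: "('a \<Rightarrow> 'a) set" where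
  "derivations = {\<delta> \<in> order_below (Suc (Suc 0)). \<delta> \<one> = \<zero>}"

lemma derivations_D: "\<delta> \<in> derivations \<Longrightarrow> \<delta> \<in> D"
  unfolding derivations_def using order_below_D by blast

text \<open>The commutator is multiplication by some function, and evaluation at 1 identifies
  it.\<close>

lemma ad_order_1:
  assumes "\<xi> \<in> order_below (Suc (Suc 0))" "f \<in> carrier R"
  shows "ad f \<xi> = \<iota> (\<xi> f \<ominus> f \<otimes> \<xi> \<one>)"
proof -
  have \<xi>: "\<xi> \<in> carrier E" using assms order_below_closed by blast
  have "ad f \<xi> \<in> \<iota> ` carrier R"
    using assms unfolding order_below.simps(2)[of "Suc 0"] order_below_1 by blast
  then obtain h where h: "h \<in> carrier R" "ad f \<xi> = \<iota> h" by blast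
  have "ad f \<xi> \<one> = \<xi> f \<ominus> f \<otimes> \<xi> \<one>" using assms(2) \<xi> by simp
  then have "h = \<xi> f \<ominus> f \<otimes> \<xi> \<one>" using h by simp
  then show ?thesis using h by simp
qed

lemma ad_derivation:
  assumes "\<delta> \<in> derivations" "f \<in> carrier R"
  shows "ad f \<delta> = \<iota> (\<delta> f)"
  using ad_order_1[of \<delta> f] assms E_closed[OF D_E[OF derivations_D[OF assms(1)]] assms(2)]
  unfolding derivations_def by (simp add: minus_eq)

lemma derivation_mult:
  assumes \<delta>: "\<delta> \<in> derivations" and f: "f \<in> carrier R" and g: "g \<in> carrier R"
  shows "\<delta> (f \<otimes> g) = \<delta> f \<otimes> g \<oplus> f \<otimes> \<delta> g"
proof -
  note cl = E_closed[OF D_E[OF derivations_D[OF \<delta>]]]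
  have "\<delta> (f \<otimes> g) \<ominus> f \<otimes> \<delta> g = \<delta> f \<otimes> g"
    using ad_derivation[OF \<delta> f] ad_apply[OF f D_E[OF derivations_D[OF \<delta>]] g] g by simp
  moreover have "\<delta> (f \<otimes> g) = (\<delta> (f \<otimes> g) \<ominus> f \<otimes> \<delta> g) \<oplus> f \<otimes> \<delta> g"
    using cl f g by (simp add: minus_eq a_assoc l_neg)
  ultimately show ?thesis by simp
qed

lemma derivations_minus:
  "\<xi> \<in> derivations \<Longrightarrow> \<eta> \<in> derivations \<Longrightarrow> \<xi> \<ominus>\<^bsub>E\<^esub> \<eta> \<in> derivations"
  unfolding derivations_def
  using order_below_minus order_below_closed[of \<xi> "Suc (Suc 0)"] order_below_closed[of \<eta> "Suc (Suc 0)"]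
  by (simp del: order_below.simps)

lemma derivations_smult:
  assumes "a \<in> carrier R" "\<xi> \<in> derivations"
  shows "\<iota> a \<otimes>\<^bsub>E\<^esub> \<xi> \<in> derivations"
proof -
  have "\<iota> a \<otimes>\<^bsub>E\<^esub> \<xi> \<in> order_below (Suc 0 + Suc (Suc 0) - 1)"
    using assms order_below_1 unfolding derivations_def by (intro order_below_mult) auto
  then show ?thesis using assms unfolding derivations_def by (simp del: order_below.simps)
qed

lemma ad_smult:
  "f \<in> carrier R \<Longrightarrow> a \<in> carrier R \<Longrightarrow> \<xi> \<in> carrier E \<Longrightarrow> ad f (\<iota> a \<otimes>\<^bsub>E\<^esub> \<xi>) = \<iota> a \<otimes>\<^bsub>E\<^esub> ad f \<xi>"
  by (simp add: ad_mult ad_\<iota>)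

lemma ad_finsum:
  assumes "finite J" "f \<in> carrier R" "\<And>j. j \<in> J \<Longrightarrow> A j \<in> carrier E"
  shows "ad f (\<Oplus>\<^bsub>E\<^esub>j\<in>J. A j) = (\<Oplus>\<^bsub>E\<^esub>j\<in>J. ad f (A j))"
  using assms
proof (induction J rule: finite_induct)
  case empty
  then show ?case by (simp add: ad_zero)
next
  case (insert i J)
  then have "A \<in> J \<rightarrow> carrier E" "(\<lambda>j. ad f (A j)) \<in> J \<rightarrow> carrier E" by auto
  with insert show ?case by (simp add: E.finsum_insert ad_add E.finsum_closed)
qed

lemma finsum_apply:
  assumes "finite J" "x \<in> carrier R" "\<And>j. j \<in> J \<Longrightarrow> A j \<in> carrier E"
  shows "(\<Oplus>\<^bsub>E\<^esub>j\<in>J. A j) x = (\<Oplus>j\<in>J. A j x)"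
  using assms
proof (induction J rule: finite_induct)
  case empty
  then show ?case by simp
next
  case (insert i J)
  then have "A \<in> J \<rightarrow> carrier E" "(\<lambda>j. A j x) \<in> J \<rightarrow> carrier R" "A i x \<in> carrier R"
    by (auto simp: E_closed)
  with insert show ?case by (simp add: E.finsum_insert E.finsum_closed)
qed

end

text \<open>This packages the result of \<open>elimination\<close> for derivations. The operators
  \<theta>_j act like s times the partial derivatives along the coordinates j in J, and e makes up
  for a frame that spans only after localization.\<close>

locale derivation_frame = algebra_operators k R
  for k :: "('k, 'x) ring_scheme" and R :: "('k, 'a, 'y) module_scheme" (structure) +
  fixes J :: "'a set" and \<theta> :: "'a \<Rightarrow> 'a \<Rightarrow> 'a" and s e :: 'a
  assumes J: "finite J" "J \<subseteq> carrier R" and s: "s \<in> carrier R" and e: "e \<in> carrier R"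
    and \<theta>: "j \<in> J \<Longrightarrow> \<theta> j \<in> derivations"
    and \<theta>_val: "i \<in> J \<Longrightarrow> j \<in> J \<Longrightarrow> \<theta> j i = (if i = j then s else \<zero>)"
    and vanish: "\<delta> \<in> derivations \<Longrightarrow> (\<And>j. j \<in> J \<Longrightarrow> \<delta> j = \<zero>) \<Longrightarrow> \<iota> e \<otimes>\<^bsub>E\<^esub> \<delta> = \<zero>\<^bsub>E\<^esub>"
begin

lemma JR: "j \<in> J \<Longrightarrow> j \<in> carrier R"
  using J by blast

lemma \<theta>_cl [simp]: "j \<in> J \<Longrightarrow> \<theta> j \<in> carrier E" "j \<in> J \<Longrightarrow> x \<in> carrier R \<Longrightarrow> \<theta> j x \<in> carrier R"
  using \<theta> derivations_D E_closed by blast+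

text \<open>Both s \<delta> and the sum of \<delta>(j) \<theta>_j are derivations with the same
  values on J, so e annihilates their difference.\<close>

lemma derivation_expand:
  assumes \<delta>: "\<delta> \<in> derivations" and x: "x \<in> carrier R"
  shows "e \<otimes> (s \<otimes> \<delta> x \<ominus> (\<Oplus>j\<in>J. \<delta> j \<otimes> \<theta> j x)) = \<zero>"
proof -
  have \<delta>E: "\<delta> \<in> carrier E" using \<delta> derivations_D by blast
  have cl: "\<And>j. j \<in> J \<Longrightarrow> \<delta> j \<in> carrier R" using E_closed[OF \<delta>E] JR by blast
  have fin: "(\<Oplus>\<^bsub>E\<^esub>j\<in>K. \<iota> (\<delta> j) \<otimes>\<^bsub>E\<^esub> \<theta> j) \<in> derivations" if "K \<subseteq> J" for K
  proof -
    have "finite K" using that J finite_subset by blast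
    then show ?thesis using that
    proof (induction K rule: finite_induct)
      case empty
      then show ?case by (simp add: derivations_def zero_order_below del: order_below.simps)
    next
      case (insert i K)
      have t: "\<iota> (\<delta> i) \<otimes>\<^bsub>E\<^esub> \<theta> i \<in> derivations" using insert.prems cl \<theta> by (auto intro: derivations_smult)
      have "(\<Oplus>\<^bsub>E\<^esub>j\<in>insert i K. \<iota> (\<delta> j) \<otimes>\<^bsub>E\<^esub> \<theta> j) =
          \<iota> (\<delta> i) \<otimes>\<^bsub>E\<^esub> \<theta> i \<oplus>\<^bsub>E\<^esub> (\<Oplus>\<^bsub>E\<^esub>j\<in>K. \<iota> (\<delta> j) \<otimes>\<^bsub>E\<^esub> \<theta> j)"
        using insert cl by (intro E.finsum_insert) auto
      then show ?case using t insert.IH insert.prems order_below_add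
        unfolding derivations_def by (simp del: order_below.simps)
    qed
  qed
  let ?\<delta>' = "\<iota> s \<otimes>\<^bsub>E\<^esub> \<delta> \<ominus>\<^bsub>E\<^esub> (\<Oplus>\<^bsub>E\<^esub>j\<in>J. \<iota> (\<delta> j) \<otimes>\<^bsub>E\<^esub> \<theta> j)"
  have c: "(\<Oplus>\<^bsub>E\<^esub>j\<in>J. \<iota> (\<delta> j) \<otimes>\<^bsub>E\<^esub> \<theta> j) \<in> carrier E" using fin derivations_D by blast
  have ap: "?\<delta>' y = s \<otimes> \<delta> y \<ominus> (\<Oplus>j\<in>J. \<delta> j \<otimes> \<theta> j y)" if y: "y \<in> carrier R" for y
  proof -
    have "(\<Oplus>\<^bsub>E\<^esub>j\<in>J. \<iota> (\<delta> j) \<otimes>\<^bsub>E\<^esub> \<theta> j) y = (\<Oplus>j\<in>J. (\<iota> (\<delta> j) \<otimes>\<^bsub>E\<^esub> \<theta> j) y)"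
      using J y cl by (intro finsum_apply) auto
    also have "\<dots> = (\<Oplus>j\<in>J. \<delta> j \<otimes> \<theta> j y)"
      using y cl by (intro finsum_cong') auto
    finally show ?thesis using y s c \<delta>E E_closed[OF \<delta>E y] by simp
  qed
  have "\<iota> e \<otimes>\<^bsub>E\<^esub> ?\<delta>' = \<zero>\<^bsub>E\<^esub>"
  proof (rule vanish)
    show "?\<delta>' \<in> derivations" using \<delta> s fin by (blast intro: derivations_minus derivations_smult)
    fix i assume i: "i \<in> J"
    have "(\<Oplus>j\<in>J. \<delta> j \<otimes> \<theta> j i) = (\<Oplus>j\<in>J. if i = j then \<delta> j \<otimes> s else \<zero>)"
      using cl i s by (intro finsum_cong') (auto simp: \<theta>_val)
    also have "\<dots> = \<delta> i \<otimes> s"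
      using finsum_singleton[OF i J(1), of "\<lambda>j. \<delta> j \<otimes> s"] cl s by auto
    finally show "?\<delta>' i = \<zero>" using ap[OF JR[OF i]] cl[OF i] s by (simp add: m_comm)
  qed
  then have "(\<iota> e \<otimes>\<^bsub>E\<^esub> ?\<delta>') x = \<zero>" using x by simp
  moreover have "?\<delta>' x \<in> carrier R" by (rule E_closed[OF _ x]) (use s \<delta>E c in auto)
  ultimately show ?thesis using x ap[OF x] by simp
qed

text \<open>A chain rule for commutators: modulo lower order, s [\<xi>, f] is the sum of [\<xi>, j]
  \<theta>_j(f). Taking \<open>ad g\<close> only replaces \<xi> by [\<xi>, g] in this expression,
  which reduces the claim to order at most one and \<open>derivation_expand\<close>.\<close>

lemma ad_expand:
  "\<xi> \<in> order_below (Suc (Suc m)) \<Longrightarrow> f \<in> carrier R \<Longrightarrow>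
    \<iota> e \<otimes>\<^bsub>E\<^esub> (\<iota> s \<otimes>\<^bsub>E\<^esub> ad f \<xi> \<ominus>\<^bsub>E\<^esub> (\<Oplus>\<^bsub>E\<^esub>j\<in>J. ad j \<xi> \<otimes>\<^bsub>E\<^esub> \<iota> (\<theta> j f))) \<in> order_below m"
proof (induction m arbitrary: \<xi>)
  case 0
  \<comment> \<open>Subtracting the function \<xi>(1) leaves a derivation with the same
    commutators.\<close>
  define \<delta> where "\<delta> = \<xi> \<ominus>\<^bsub>E\<^esub> \<iota> (\<xi> \<one>)"
  have \<xi>E: "\<xi> \<in> carrier E" using 0 order_below_closed by blast
  have \<xi>1: "\<xi> \<one> \<in> carrier R" by (rule E_closed[OF \<xi>E one_closed])
  have "\<iota> (\<xi> \<one>) \<in> order_below (Suc 0)" using \<xi>1 order_below_1 by blast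
  then have "\<iota> (\<xi> \<one>) \<in> order_below (Suc (Suc 0))" by (rule order_below_mono[rotated]) simp
  then have \<delta>: "\<delta> \<in> derivations"
    using 0 order_below_minus[of \<xi> _ "\<iota> (\<xi> \<one>)"] \<xi>E \<xi>1 unfolding \<delta>_def derivations_def
    by (simp del: order_below.simps)
  have \<delta>E: "\<delta> \<in> carrier E" using \<delta> derivations_D by blast
  note cl = E_closed[OF \<delta>E]
  have ad: "ad g \<xi> = \<iota> (\<delta> g)" if g: "g \<in> carrier R" for g
    using ad_order_1[OF 0(1) g] \<xi>E \<xi>1 g by (simp add: \<delta>_def m_comm)
  have "(\<Oplus>\<^bsub>E\<^esub>j\<in>J. ad j \<xi> \<otimes>\<^bsub>E\<^esub> \<iota> (\<theta> j f)) \<in> carrier E"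
    using \<xi>E 0(2) JR by (intro E.finsum_closed) auto
  moreover have "(\<Oplus>\<^bsub>E\<^esub>j\<in>J. ad j \<xi> \<otimes>\<^bsub>E\<^esub> \<iota> (\<theta> j f)) x = (\<Oplus>j\<in>J. \<delta> j \<otimes> \<theta> j f) \<otimes> x"
    if x: "x \<in> carrier R" for x
  proof -
    have "(\<Oplus>\<^bsub>E\<^esub>j\<in>J. ad j \<xi> \<otimes>\<^bsub>E\<^esub> \<iota> (\<theta> j f)) x = (\<Oplus>j\<in>J. (ad j \<xi> \<otimes>\<^bsub>E\<^esub> \<iota> (\<theta> j f)) x)"
      using J x \<xi>E 0(2) JR by (intro finsum_apply) auto
    also have "\<dots> = (\<Oplus>j\<in>J. \<delta> j \<otimes> \<theta> j f \<otimes> x)"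
      using x 0(2) JR cl ad by (intro finsum_cong') (auto simp: m_assoc)
    also have "\<dots> = (\<Oplus>j\<in>J. \<delta> j \<otimes> \<theta> j f) \<otimes> x"
      using J x 0(2) JR cl by (subst finsum_ldistr) auto
    finally show ?thesis .
  qed
  moreover have "(\<Oplus>j\<in>J. \<delta> j \<otimes> \<theta> j f) \<in> carrier R" using JR cl 0(2) by (intro finsum_closed) auto
  moreover have "e \<otimes> (s \<otimes> (\<delta> f \<otimes> x) \<ominus> S \<otimes> x) = e \<otimes> (s \<otimes> \<delta> f \<ominus> S) \<otimes> x"
    if "S \<in> carrier R" "x \<in> carrier R" for S x
    using that e s cl[OF 0(2)] by algebra
  ultimately have "\<iota> e \<otimes>\<^bsub>E\<^esub> (\<iota> s \<otimes>\<^bsub>E\<^esub> ad f \<xi> \<ominus>\<^bsub>E\<^esub> (\<Oplus>\<^bsub>E\<^esub>j\<in>J. ad j \<xi> \<otimes>\<^bsub>E\<^esub> \<iota> (\<theta> j f))) = \<zero>\<^bsub>E\<^esub>"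
    using e s \<xi>E 0(2) derivation_expand[OF \<delta> 0(2)] cl[OF 0(2)]
    by (intro E_eqI) (auto simp: ad[OF 0(2)])
  then show ?case by simp
next
  case (Suc m)
  note f = Suc.prems(2)
  have \<xi>E: "\<xi> \<in> carrier E" using Suc.prems order_below_closed by blast
  have c: "(\<Oplus>\<^bsub>E\<^esub>j\<in>J. ad j \<xi> \<otimes>\<^bsub>E\<^esub> \<iota> (\<theta> j f)) \<in> carrier E"
    using \<xi>E f JR by (intro E.finsum_closed) auto
  show ?case unfolding order_below.simps(2)
  proof (intro CollectI conjI ballI)
    fix g assume g: "g \<in> carrier R"
    have "ad g \<xi> \<in> order_below (Suc (Suc m))"
      using Suc.prems(1) g unfolding order_below.simps(2)[of "Suc (Suc m)"] by blast
    note IH = Suc.IH[OF this f]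
    have "ad g (\<Oplus>\<^bsub>E\<^esub>j\<in>J. ad j \<xi> \<otimes>\<^bsub>E\<^esub> \<iota> (\<theta> j f)) = (\<Oplus>\<^bsub>E\<^esub>j\<in>J. ad g (ad j \<xi> \<otimes>\<^bsub>E\<^esub> \<iota> (\<theta> j f)))"
      using J g \<xi>E f JR by (intro ad_finsum) auto
    also have "\<dots> = (\<Oplus>\<^bsub>E\<^esub>j\<in>J. ad j (ad g \<xi>) \<otimes>\<^bsub>E\<^esub> \<iota> (\<theta> j f))"
      using g \<xi>E f JR by (intro E.finsum_cong') (auto simp: ad_mult ad_\<iota> ad_comm[of g])
    finally show "ad g (\<iota> e \<otimes>\<^bsub>E\<^esub> (\<iota> s \<otimes>\<^bsub>E\<^esub> ad f \<xi> \<ominus>\<^bsub>E\<^esub> (\<Oplus>\<^bsub>E\<^esub>j\<in>J. ad j \<xi> \<otimes>\<^bsub>E\<^esub> \<iota> (\<theta> j f)))) \<in> order_below m"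
      using IH g e s f \<xi>E c by (simp add: ad_smult ad_minus_op ad_comm[of g f])
  qed (use e s f \<xi>E c in auto)
qed

text \<open>This is Euler's identity for the symbol of \<xi>, a form of degree m in the frame on
  which \<open>ad j\<close> acts as a partial derivative. It is proved by applying
  \<open>ad f\<close>: commuting f past \<theta>_j gives an \<open>ad_expand\<close> term with
  coefficient s, and commuting it past [\<xi>, j] gives the identity for [\<xi>, f] with coefficient
  m s.\<close>

lemma euler_identity:
  "\<xi> \<in> order_below (Suc m) \<Longrightarrow>
    \<iota> e \<otimes>\<^bsub>E\<^esub> (\<iota> (add_pow R m s) \<otimes>\<^bsub>E\<^esub> \<xi> \<ominus>\<^bsub>E\<^esub> (\<Oplus>\<^bsub>E\<^esub>j\<in>J. ad j \<xi> \<otimes>\<^bsub>E\<^esub> \<theta> j)) \<in> order_below m"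
proof (induction m arbitrary: \<xi>)
  case 0
  have \<xi>E: "\<xi> \<in> carrier E" using 0 order_below_closed by blast
  have "(\<Oplus>\<^bsub>E\<^esub>j\<in>J. ad j \<xi> \<otimes>\<^bsub>E\<^esub> \<theta> j) = (\<Oplus>\<^bsub>E\<^esub>j\<in>J. \<zero>\<^bsub>E\<^esub>)"
    using 0 JR by (intro E.finsum_cong') auto
  then show ?case using e \<xi>E by (simp add: \<iota>_zero E.minus_eq)
next
  case (Suc m)
  have \<xi>E: "\<xi> \<in> carrier E" using Suc.prems order_below_closed by blast
  have ms: "add_pow R m s \<in> carrier R" "add_pow R (Suc m) s \<in> carrier R" using s by blast+
  have c: "(\<Oplus>\<^bsub>E\<^esub>j\<in>J. ad j \<xi> \<otimes>\<^bsub>E\<^esub> \<theta> j) \<in> carrier E"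
    using \<xi>E JR by (intro E.finsum_closed) auto
  show ?case unfolding order_below.simps(2)
  proof (intro CollectI conjI ballI)
    fix f assume f: "f \<in> carrier R"
    have fE: "ad f \<xi> \<in> carrier E" using f \<xi>E by blast
    have "ad f \<xi> \<in> order_below (Suc m)"
      using Suc.prems f unfolding order_below.simps(2)[of "Suc m"] by blast
    note IH = Suc.IH[OF this] and T = ad_expand[OF Suc.prems f]
    have c1: "(\<Oplus>\<^bsub>E\<^esub>j\<in>J. ad j (ad f \<xi>) \<otimes>\<^bsub>E\<^esub> \<theta> j) \<in> carrier E"
      using fE JR by (intro E.finsum_closed) auto
    have c2: "(\<Oplus>\<^bsub>E\<^esub>j\<in>J. ad j \<xi> \<otimes>\<^bsub>E\<^esub> \<iota> (\<theta> j f)) \<in> carrier E"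
      using \<xi>E f JR by (intro E.finsum_closed) auto
    have "ad f (\<Oplus>\<^bsub>E\<^esub>j\<in>J. ad j \<xi> \<otimes>\<^bsub>E\<^esub> \<theta> j) = (\<Oplus>\<^bsub>E\<^esub>j\<in>J. ad f (ad j \<xi> \<otimes>\<^bsub>E\<^esub> \<theta> j))"
      using J f \<xi>E JR by (intro ad_finsum) auto
    also have "\<dots> = (\<Oplus>\<^bsub>E\<^esub>j\<in>J. ad j \<xi> \<otimes>\<^bsub>E\<^esub> \<iota> (\<theta> j f) \<oplus>\<^bsub>E\<^esub> ad j (ad f \<xi>) \<otimes>\<^bsub>E\<^esub> \<theta> j)"
      using f \<xi>E fE JR by (intro E.finsum_cong') (auto simp: ad_mult ad_derivation[OF \<theta>] ad_comm[of f])
    also have "\<dots> = (\<Oplus>\<^bsub>E\<^esub>j\<in>J. ad j \<xi> \<otimes>\<^bsub>E\<^esub> \<iota> (\<theta> j f)) \<oplus>\<^bsub>E\<^esub> (\<Oplus>\<^bsub>E\<^esub>j\<in>J. ad j (ad f \<xi>) \<otimes>\<^bsub>E\<^esub> \<theta> j)"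
      using f \<xi>E fE JR by (intro E.finsum_addf) auto
    finally have A: "ad f (\<Oplus>\<^bsub>E\<^esub>j\<in>J. ad j \<xi> \<otimes>\<^bsub>E\<^esub> \<theta> j) = \<dots>" .
    have B: "\<iota> (add_pow R (Suc m) s) = \<iota> (add_pow R m s) \<oplus>\<^bsub>E\<^esub> \<iota> s"
      using \<iota>_add[OF ms(1) s] by simp
    \<comment> \<open>The coefficient (m+1) s is split as m s + s, one part for the induction
      hypothesis and one for \<open>ad_expand\<close>.\<close>
    have regroup: "a \<otimes>\<^bsub>E\<^esub> ((b \<oplus>\<^bsub>E\<^esub> d) \<otimes>\<^bsub>E\<^esub> x \<ominus>\<^bsub>E\<^esub> (Z \<oplus>\<^bsub>E\<^esub> Y)) =
        a \<otimes>\<^bsub>E\<^esub> (b \<otimes>\<^bsub>E\<^esub> x \<ominus>\<^bsub>E\<^esub> Y) \<oplus>\<^bsub>E\<^esub> a \<otimes>\<^bsub>E\<^esub> (d \<otimes>\<^bsub>E\<^esub> x \<ominus>\<^bsub>E\<^esub> Z)"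
      if "Y \<in> carrier E" "Z \<in> carrier E" "x \<in> carrier E" "a \<in> carrier E" "d \<in> carrier E" "b \<in> carrier E"
      for a b d x Y Z using that by algebra
    have "ad f (\<iota> e \<otimes>\<^bsub>E\<^esub> (\<iota> (add_pow R (Suc m) s) \<otimes>\<^bsub>E\<^esub> \<xi> \<ominus>\<^bsub>E\<^esub> (\<Oplus>\<^bsub>E\<^esub>j\<in>J. ad j \<xi> \<otimes>\<^bsub>E\<^esub> \<theta> j)))
      = \<iota> e \<otimes>\<^bsub>E\<^esub> (\<iota> (add_pow R (Suc m) s) \<otimes>\<^bsub>E\<^esub> ad f \<xi> \<ominus>\<^bsub>E\<^esub> ad f (\<Oplus>\<^bsub>E\<^esub>j\<in>J. ad j \<xi> \<otimes>\<^bsub>E\<^esub> \<theta> j))"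
      using f e ms \<xi>E c by (simp add: ad_smult ad_minus_op del: add.nat_pow_Suc)
    also have "\<dots> = \<iota> e \<otimes>\<^bsub>E\<^esub> (\<iota> (add_pow R m s) \<otimes>\<^bsub>E\<^esub> ad f \<xi> \<ominus>\<^bsub>E\<^esub> (\<Oplus>\<^bsub>E\<^esub>j\<in>J. ad j (ad f \<xi>) \<otimes>\<^bsub>E\<^esub> \<theta> j))
      \<oplus>\<^bsub>E\<^esub> \<iota> e \<otimes>\<^bsub>E\<^esub> (\<iota> s \<otimes>\<^bsub>E\<^esub> ad f \<xi> \<ominus>\<^bsub>E\<^esub> (\<Oplus>\<^bsub>E\<^esub>j\<in>J. ad j \<xi> \<otimes>\<^bsub>E\<^esub> \<iota> (\<theta> j f)))"
      unfolding A B using c1 c2 fE \<iota>_closed[OF e] \<iota>_closed[OF s] \<iota>_closed[OF ms(1)]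
      by (rule regroup)
    finally show "ad f (\<iota> e \<otimes>\<^bsub>E\<^esub> (\<iota> (add_pow R (Suc m) s) \<otimes>\<^bsub>E\<^esub> \<xi> \<ominus>\<^bsub>E\<^esub> (\<Oplus>\<^bsub>E\<^esub>j\<in>J. ad j \<xi> \<otimes>\<^bsub>E\<^esub> \<theta> j))) \<in> order_below m"
      using order_below_add[OF IH T] by simp
  qed (use e ms \<xi>E c in auto)
qed

end

theorem (in anti_automorphism) \<Phi>\<Phi>_char_0:
  assumes red: "reduced_ring R"
    and inv: "\<And>m a. 0 < m \<Longrightarrow> a \<in> carrier R \<Longrightarrow> add_pow R (m::nat) a = \<zero> \<Longrightarrow> a = \<zero>"
    and B: "finite B" "B \<subseteq> carrier R"
    and det: "\<And>\<delta>. \<delta> \<in> derivations \<Longrightarrow> (\<And>b. b \<in> B \<Longrightarrow> \<delta> b = \<zero>) \<Longrightarrow> \<delta> = \<zero>\<^bsub>E\<^esub>"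
  shows "\<xi> \<in> order_below (Suc (Suc n)) \<Longrightarrow> \<Phi> (\<Phi> \<xi>) = \<xi>"
proof (induction n arbitrary: \<xi>)
  case 0
  then show ?case by (rule \<Phi>\<Phi>_order_1)
next
  case (Suc n)
  show ?case
  proof (rule ccontr)
    assume neq: "\<Phi> (\<Phi> \<xi>) \<noteq> \<xi>"
    have \<xi>D: "\<xi> \<in> D" using Suc.prems order_below_D by blast
    have cl: "\<xi> x \<in> carrier R" "\<Phi> (\<Phi> \<xi>) x \<in> carrier R" if "x \<in> carrier R" for x
      using that \<xi>D E_closed[OF D_E] by auto
    obtain x\<^sub>0 where x\<^sub>0: "x\<^sub>0 \<in> carrier R" and "\<Phi> (\<Phi> \<xi>) x\<^sub>0 \<noteq> \<xi> x\<^sub>0"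
      using neq E_eqI[of "\<Phi> (\<Phi> \<xi>)" \<xi>] \<xi>D by auto
    define c where "c = \<Phi> (\<Phi> \<xi>) x\<^sub>0 \<ominus> \<xi> x\<^sub>0"
    have c: "c \<in> carrier R" "c \<noteq> \<zero>"
      using cl[OF x\<^sub>0] \<open>\<Phi> (\<Phi> \<xi>) x\<^sub>0 \<noteq> \<xi> x\<^sub>0\<close> by (simp_all add: c_def)
    obtain J s \<theta> where J: "J \<subseteq> B" and s: "s \<in> carrier R" "s \<otimes> c \<noteq> \<zero>"
      and \<theta>: "\<And>j. j \<in> J \<Longrightarrow> \<theta> j \<in> derivations"
        "\<And>i j. i \<in> J \<Longrightarrow> j \<in> J \<Longrightarrow> \<theta> j i = (if i = j then s else \<zero>)"
      and van: "\<And>\<xi>. \<xi> \<in> derivations \<Longrightarrow> (\<And>j. j \<in> J \<Longrightarrow> \<xi> j = \<zero>) \<Longrightarrow> \<iota> (s \<otimes> c) \<otimes>\<^bsub>E\<^esub> \<xi> = \<zero>\<^bsub>E\<^esub>"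
      by (rule elimination[OF _ derivations_smult derivations_minus B det c])
        (use derivations_D in blast)+
    define e where "e = s \<otimes> c"
    have e: "e \<in> carrier R" using s c by (simp add: e_def)
    interpret frame: derivation_frame k R J \<theta> s e
      using J B s e \<theta> van unfolding e_def by unfold_locales (auto intro: finite_subset)
    let ?m = "Suc (Suc n)"
    define F where "F = {\<eta> \<in> D. \<Phi> (\<Phi> \<eta>) = \<eta>}"
    have F_add: "\<eta> \<oplus>\<^bsub>E\<^esub> \<zeta> \<in> F" if "\<eta> \<in> F" "\<zeta> \<in> F" for \<eta> \<zeta>
      using that unfolding F_def by (simp add: \<Phi>_add)
    have F_mult: "\<eta> \<otimes>\<^bsub>E\<^esub> \<zeta> \<in> F" if "\<eta> \<in> F" "\<zeta> \<in> F" for \<eta> \<zeta>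
      using that unfolding F_def by (simp add: \<Phi>_mult)
    have F_\<iota>: "\<iota> a \<in> F" if "a \<in> carrier R" for a
      using that unfolding F_def by (simp add: \<Phi>_\<iota>)
    have F_zero: "\<zero>\<^bsub>E\<^esub> \<in> F" using F_\<iota>[OF zero_closed] \<iota>_zero by simp
    have F_order: "\<eta> \<in> F" if "\<eta> \<in> order_below ?m" for \<eta>
      using that Suc.IH order_below_D unfolding F_def by blast
    have summand: "ad j \<xi> \<otimes>\<^bsub>E\<^esub> \<theta> j \<in> F" if j: "j \<in> J" for j
    proof (rule F_mult)
      show "ad j \<xi> \<in> F"
        using F_order Suc.prems frame.JR[OF j] unfolding order_below.simps(2)[of ?m] by blast
      \<comment> \<open>The induction starts at order one, so the derivations of the frame are
        already covered.\<close>
      have "\<theta> j \<in> order_below (Suc (Suc 0))" using \<theta>(1)[OF j] unfolding derivations_def by blast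
      then show "\<theta> j \<in> F" by (intro F_order order_below_mono[of "Suc (Suc 0)" ?m]) simp_all
    qed
    have sum: "(\<Oplus>\<^bsub>E\<^esub>j\<in>K. ad j \<xi> \<otimes>\<^bsub>E\<^esub> \<theta> j) \<in> F" if "finite K" "K \<subseteq> J" for K
      using that
    proof (induction K rule: finite_induct)
      case empty
      then show ?case using F_zero by simp
    next
      case (insert i K)
      have "(\<Oplus>\<^bsub>E\<^esub>j\<in>insert i K. ad j \<xi> \<otimes>\<^bsub>E\<^esub> \<theta> j) = ad i \<xi> \<otimes>\<^bsub>E\<^esub> \<theta> i \<oplus>\<^bsub>E\<^esub> (\<Oplus>\<^bsub>E\<^esub>j\<in>K. ad j \<xi> \<otimes>\<^bsub>E\<^esub> \<theta> j)"
        using insert frame.JR \<xi>D by (intro E.finsum_insert) auto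
      then show ?case using F_add summand insert by simp
    qed
    let ?S = "\<Oplus>\<^bsub>E\<^esub>j\<in>J. ad j \<xi> \<otimes>\<^bsub>E\<^esub> \<theta> j"
    have S: "?S \<in> F" by (rule sum[OF frame.J(1) order_refl])
    then have SE: "?S \<in> carrier E" unfolding F_def by auto
    define a where "a = add_pow R ?m s"
    have a: "a \<in> carrier R" using s by (simp add: a_def del: add.nat_pow_Suc)
    \<comment> \<open>Euler's identity lands in \<open>order_below ?m\<close>, exactly the range of
      the induction hypothesis.\<close>
    have U: "\<iota> e \<otimes>\<^bsub>E\<^esub> (\<iota> a \<otimes>\<^bsub>E\<^esub> \<xi> \<ominus>\<^bsub>E\<^esub> ?S) \<in> F"
      using F_order[OF frame.euler_identity[OF Suc.prems]] unfolding a_def .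
    have "\<iota> e \<otimes>\<^bsub>E\<^esub> (\<iota> a \<otimes>\<^bsub>E\<^esub> \<xi>)
        = \<iota> e \<otimes>\<^bsub>E\<^esub> (\<iota> a \<otimes>\<^bsub>E\<^esub> \<xi> \<ominus>\<^bsub>E\<^esub> ?S) \<oplus>\<^bsub>E\<^esub> \<iota> e \<otimes>\<^bsub>E\<^esub> ?S"
    proof -
      have "\<iota> e \<in> carrier E" "\<iota> a \<otimes>\<^bsub>E\<^esub> \<xi> \<in> carrier E" using e a \<xi>D by auto
      then show ?thesis using SE
        by (simp add: E.minus_eq E.r_distr[symmetric] E.a_assoc E.l_neg)
    qed
    then have "\<iota> e \<otimes>\<^bsub>E\<^esub> (\<iota> a \<otimes>\<^bsub>E\<^esub> \<xi>) \<in> F" using F_add[OF U F_mult[OF F_\<iota>[OF e] S]] by simp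
    then have "\<Phi> (\<Phi> (\<iota> e \<otimes>\<^bsub>E\<^esub> (\<iota> a \<otimes>\<^bsub>E\<^esub> \<xi>))) = \<iota> e \<otimes>\<^bsub>E\<^esub> (\<iota> a \<otimes>\<^bsub>E\<^esub> \<xi>)"
      unfolding F_def by blast
    then have "(\<iota> e \<otimes>\<^bsub>E\<^esub> (\<iota> a \<otimes>\<^bsub>E\<^esub> \<Phi> (\<Phi> \<xi>))) x\<^sub>0 = (\<iota> e \<otimes>\<^bsub>E\<^esub> (\<iota> a \<otimes>\<^bsub>E\<^esub> \<xi>)) x\<^sub>0"
      using e a \<xi>D E.m_assoc by (simp add: \<Phi>_mult \<Phi>_\<iota>)
    then have 1: "e \<otimes> (a \<otimes> \<Phi> (\<Phi> \<xi>) x\<^sub>0) = e \<otimes> (a \<otimes> \<xi> x\<^sub>0)"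
      using x\<^sub>0 a cl by simp
    have "e \<otimes> a \<otimes> c = e \<otimes> (a \<otimes> \<Phi> (\<Phi> \<xi>) x\<^sub>0) \<ominus> e \<otimes> (a \<otimes> \<xi> x\<^sub>0)"
      unfolding c_def using e a cl[OF x\<^sub>0] by algebra
    also have "\<dots> = \<zero>" unfolding 1 using e a cl[OF x\<^sub>0] by simp
    finally have "a \<otimes> (e \<otimes> c) = \<zero>" using e a c by (simp add: m_ac)
    then have "add_pow R ?m (s \<otimes> (e \<otimes> c)) = \<zero>"
      unfolding a_def using add_pow_ldistr[of s "e \<otimes> c" ?m] s e c by simp
    then have "s \<otimes> (e \<otimes> c) = \<zero>" by (rule inv[of ?m, rotated 2]) (use s e c in auto)
    \<comment> \<open>Regrouping s (e c) as e (s c) exhibits the square of e.\<close>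
    moreover have "s \<otimes> (e \<otimes> c) = e \<otimes> e"
      unfolding m_comm[OF e c(1)] m_assoc[OF s(1) c(1) e, symmetric] e_def[symmetric] ..
    ultimately have "e [^] (2::nat) = \<zero>" using e by (simp add: numeral_eq_Suc)
    then have "e = \<zero>" using red e unfolding reduced_ring_def by blast
    then show False using s(2) e_def by simp
  qed
qed

section \<open>Algebras essentially of finite type\<close>

context algebra_operators
begin

abbreviation subalgebra_gen :: "'a set \<Rightarrow> 'a set" where
  "subalgebra_gen T \<equiv> generate_ring R (structure_map R ` carrier k \<union> T)"

lemma structure_maps_closed: "structure_map R ` carrier k \<subseteq> carrier R"
  using structure_map_closed by blast

text \<open>The localization map sends A into the subalgebra generated by the images of its
  generators, so A can be replaced by a subalgebra of R and no longer appears.\<close>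

lemma essentially_of_finite_type_generators:
  assumes "essentially_of_finite_type TYPE('b) k R"
  obtains T where "finite T" "T \<subseteq> carrier R"
    "\<And>r. r \<in> carrier R \<Longrightarrow> \<exists>a\<in>subalgebra_gen T. \<exists>s\<in>subalgebra_gen T. s \<in> Units R \<and> r = a \<otimes> inv s"
proof -
  obtain A :: "('k, 'b) module" and S \<phi> where fg: "finitely_generated_algebra k A"
    and loc: "is_localization A S R \<phi>"
    and lin: "\<And>c a. c \<in> carrier k \<Longrightarrow> a \<in> carrier A \<Longrightarrow> \<phi> (c \<odot>\<^bsub>A\<^esub> a) = c \<odot>\<^bsub>R\<^esub> \<phi> a"
    using assms unfolding essentially_of_finite_type_def by blast
  obtain G where G: "finite G" "G \<subseteq> carrier A"
    "carrier A = generate_ring A (structure_map A ` carrier k \<union> G)" and A: "algebra k A"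
    using fg unfolding finitely_generated_algebra_def by blast
  have "cring A" using A by (rule algebra.M_cring)
  have hom: "\<phi> \<in> ring_hom A R" and S: "S \<subseteq> carrier A" "\<phi> ` S \<subseteq> Units R"
    and frac: "\<And>r. r \<in> carrier R \<Longrightarrow> \<exists>a\<in>carrier A. \<exists>s\<in>S. r = \<phi> a \<otimes> inv (\<phi> s)"
    using loc submonoid.subset unfolding is_localization_def by blast+
  interpret \<phi>: ring_hom_ring A R \<phi>
    using \<open>cring A\<close> hom by (intro ring_hom_ringI2) (auto intro: cring.axioms ring_axioms)
  have "\<phi> a \<in> subalgebra_gen (\<phi> ` G)" if "a \<in> generate_ring A (structure_map A ` carrier k \<union> G)" for a
    using that
  proof (induction rule: generate_ring.induct)
    case one
    then show ?case using generate_ring.one by simp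
  next
    case (incl h)
    then show ?case
    proof
      assume "h \<in> structure_map A ` carrier k"
      then obtain c where c: "c \<in> carrier k" "h = structure_map A c" by blast
      then have "\<phi> h = structure_map R c" using lin[of c "\<one>\<^bsub>A\<^esub>"] by (simp add: structure_map_def)
      then show ?thesis using c(1) by (auto intro: generate_ring.incl)
    qed (auto intro: generate_ring.incl)
  next
    case (a_inv h)
    have "h \<in> carrier A" using a_inv(1) G(3) by simp
    then show ?case using a_inv(2) by (simp add: generate_ring.a_inv)
  next
    case (eng_add h1 h2)
    have "h1 \<in> carrier A" "h2 \<in> carrier A" using eng_add(1,2) G(3) by simp_all
    then show ?case using eng_add(3,4) by (simp add: generate_ring.eng_add)
  next
    case (eng_mult h1 h2)
    have "h1 \<in> carrier A" "h2 \<in> carrier A" using eng_mult(1,2) G(3) by simp_all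
    then show ?case using eng_mult(3,4) by (simp add: generate_ring.eng_mult)
  qed
  then have gen: "\<phi> a \<in> subalgebra_gen (\<phi> ` G)" if "a \<in> carrier A" for a using that G(3) by simp
  show thesis
  proof (rule that[of "\<phi> ` G"])
    show "finite (\<phi> ` G)" using G by simp
    show "\<phi> ` G \<subseteq> carrier R" using G(2) by auto
    fix r assume "r \<in> carrier R"
    then obtain a s where "a \<in> carrier A" "s \<in> S" "r = \<phi> a \<otimes> inv (\<phi> s)" using frac by blast
    then show "\<exists>a\<in>subalgebra_gen (\<phi> ` G). \<exists>s\<in>subalgebra_gen (\<phi> ` G). s \<in> Units R \<and> r = a \<otimes> inv s"
      using gen S by blast
  qed
qed

text \<open>The derivation vanishes on the generated subalgebra by the Leibniz rule. For a fraction
  r = a/s, applying it to s r = a gives s \<delta>(r) = 0 with s a unit.\<close>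

lemma derivation_eq_zero:
  assumes T: "T \<subseteq> carrier R"
    and frac: "\<And>r. r \<in> carrier R \<Longrightarrow>
      \<exists>a\<in>subalgebra_gen T. \<exists>s\<in>subalgebra_gen T. s \<in> Units R \<and> r = a \<otimes> inv s"
    and \<delta>: "\<delta> \<in> derivations" and van: "\<And>x. x \<in> T \<Longrightarrow> \<delta> x = \<zero>"
  shows "\<delta> = \<zero>\<^bsub>E\<^esub>"
proof -
  have \<delta>E: "\<delta> \<in> carrier E" using \<delta> derivations_D by blast
  have \<delta>1: "\<delta> \<one> = \<zero>" using \<delta> by (simp add: derivations_def)
  have Z: "structure_map R ` carrier k \<union> T \<subseteq> carrier R" using T structure_maps_closed by blast
  have gen: "a \<in> carrier R \<and> \<delta> a = \<zero>" if "a \<in> subalgebra_gen T" for a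
    using that
  proof (induction rule: generate_ring.induct)
    case (incl h)
    then show ?case
    proof
      assume "h \<in> structure_map R ` carrier k"
      then show ?thesis using E_smult[OF \<delta>E] \<delta>1 structure_maps_closed
        by (auto simp: structure_map_def smult_zero)
    qed (use van T in auto)
  qed (auto simp: \<delta>1 E_neg[OF \<delta>E] E_add[OF \<delta>E] derivation_mult[OF \<delta>])
  show ?thesis
  proof (rule E_eqI[OF \<delta>E])
    fix r assume r: "r \<in> carrier R"
    then obtain a s where as: "a \<in> subalgebra_gen T" "s \<in> subalgebra_gen T" and s: "s \<in> Units R"
      and "r = a \<otimes> inv s" using frac by blast
    then have sr: "s \<otimes> r = a" using gen[OF as(1)] by (simp add: m_lcomm Units_closed)
    have c: "\<delta> r \<in> carrier R" using E_closed[OF \<delta>E r] .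
    have "s \<otimes> \<delta> r = \<delta> (s \<otimes> r)" using derivation_mult[OF \<delta> Units_closed[OF s] r] gen[OF as(2)] r c s
      by (simp add: Units_closed)
    also have "\<dots> = \<zero>" using gen[OF as(1)] sr by simp
    finally have "inv s \<otimes> (s \<otimes> \<delta> r) = \<zero>" using s by simp
    then show "\<delta> r = \<zero>\<^bsub>E\<^esub> r" using s c r by (simp add: m_assoc[symmetric] Units_closed)
  qed simp
qed

section \<open>Monomials in the generators, reduced modulo q-th powers\<close>

definition monomial :: "'a set \<Rightarrow> ('a \<Rightarrow> nat) \<Rightarrow> 'a" where
  "monomial T \<alpha> = (\<Otimes>x\<in>T. x [^] \<alpha> x)"

lemma monomial_closed: "T \<subseteq> carrier R \<Longrightarrow> monomial T \<alpha> \<in> carrier R"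
  unfolding monomial_def by (intro finprod_closed) auto

lemma finprod_pow:
  assumes "finite T" "f \<in> T \<rightarrow> carrier R"
  shows "(\<Otimes>x\<in>T. f x) [^] (n::nat) = (\<Otimes>x\<in>T. f x [^] n)"
  using assms
proof (induction T rule: finite_induct)
  case (insert x T)
  then have "f x \<in> carrier R" "f \<in> T \<rightarrow> carrier R" "(\<lambda>x. f x [^] n) \<in> T \<rightarrow> carrier R" by auto
  with insert show ?case by (simp add: finprod_insert nat_pow_distrib finprod_closed)
qed simp

text \<open>Exponents are divided by q with remainder. Restricting the remainders to T places them
  in the finite set \<open>T \<rightarrow>\<^sub>E {..<q}\<close>.\<close>

lemma monomial_decompose:
  assumes "finite T" "T \<subseteq> carrier R"
  shows "monomial T \<alpha> = monomial T (\<lambda>x. \<alpha> x div q) [^] q \<otimes> monomial T (\<lambda>x\<in>T. \<alpha> x mod q)"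
proof -
  have f: "(\<lambda>x. x [^] \<beta> x) \<in> T \<rightarrow> carrier R" for \<beta> :: "'a \<Rightarrow> nat" using assms(2) by auto
  have g: "(\<lambda>x. (x [^] \<beta> x) [^] q) \<in> T \<rightarrow> carrier R" for \<beta> :: "'a \<Rightarrow> nat" using assms(2) by auto
  have "monomial T (\<lambda>x. \<alpha> x div q) [^] q \<otimes> monomial T (\<lambda>x\<in>T. \<alpha> x mod q)
      = (\<Otimes>x\<in>T. (x [^] (\<alpha> x div q)) [^] q \<otimes> x [^] ((\<lambda>x\<in>T. \<alpha> x mod q) x))"
    unfolding monomial_def finprod_pow[OF assms(1) f] by (rule finprod_multf[OF g f, symmetric])
  also have "\<dots> = monomial T \<alpha>"
    unfolding monomial_def
  proof (rule finprod_cong')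
    fix x assume x: "x \<in> T"
    then have "(x [^] (\<alpha> x div q)) [^] q \<otimes> x [^] (\<alpha> x mod q) = x [^] (\<alpha> x div q * q + \<alpha> x mod q)"
      using assms(2) by (subst nat_pow_pow, blast, subst nat_pow_mult) auto
    then show "(x [^] (\<alpha> x div q)) [^] q \<otimes> x [^] ((\<lambda>x\<in>T. \<alpha> x mod q) x) = x [^] \<alpha> x"
      using x by simp
  qed (use f in auto)
  finally show ?thesis by simp
qed

lemma monomial_Suc:
  assumes "finite T" "T \<subseteq> carrier R" and x: "x \<in> T"
  shows "monomial T (\<alpha>(x := Suc (\<alpha> x))) = x \<otimes> monomial T \<alpha>"
proof -
  have f: "(\<lambda>y. y [^] \<alpha> y) \<in> T \<rightarrow> carrier R" "(\<lambda>y. if x = y then y else \<one>) \<in> T \<rightarrow> carrier R"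
    using assms(2) by auto
  have "monomial T (\<alpha>(x := Suc (\<alpha> x))) = (\<Otimes>y\<in>T. (if x = y then y else \<one>) \<otimes> y [^] \<alpha> y)"
    unfolding monomial_def using assms(2) by (intro finprod_cong') (auto simp: m_comm subset_iff)
  also have "\<dots> = (\<Otimes>y\<in>T. if x = y then y else \<one>) \<otimes> monomial T \<alpha>"
    unfolding monomial_def by (rule finprod_multf[OF f(2,1)])
  also have "(\<Otimes>y\<in>T. if x = y then y else \<one>) = x"
    using finprod_singleton[OF x assms(1), of "\<lambda>y. y"] assms(2) by auto
  finally show ?thesis .
qed

text \<open>Over q-th powers, R is generated by the finitely many monomials with exponents below q;
  a denominator can be replaced by its q-th power, which passes through \<xi>.\<close>

lemma power_linear_eq_zero:
  assumes T: "finite T" "T \<subseteq> carrier R" and q: "0 < q"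
    and frac: "\<And>r. r \<in> carrier R \<Longrightarrow>
      \<exists>a\<in>subalgebra_gen T. \<exists>s\<in>subalgebra_gen T. s \<in> Units R \<and> r = a \<otimes> inv s"
    and \<xi>: "\<xi> \<in> power_linear q"
    and van: "\<And>b. b \<in> monomial T ` (T \<rightarrow>\<^sub>E {..<q}) \<Longrightarrow> \<xi> b = \<zero>"
  shows "\<xi> = \<zero>\<^bsub>E\<^esub>"
proof -
  have \<xi>E: "\<xi> \<in> carrier E" using \<xi> power_linear_D by blast
  note mon = monomial_closed[OF T(2)]
  have mon_van: "\<xi> (monomial T \<alpha>) = \<zero>" for \<alpha>
  proof -
    have "(\<lambda>x\<in>T. \<alpha> x mod q) \<in> T \<rightarrow>\<^sub>E {..<q}" using q by auto
    then have "\<xi> (monomial T (\<lambda>x\<in>T. \<alpha> x mod q)) = \<zero>" using van by blast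
    then show ?thesis
      unfolding monomial_decompose[OF T, of \<alpha> q] power_linear_apply[OF \<xi> mon mon] using mon by simp
  qed
  \<comment> \<open>Quantifying over all monomials makes M stable under multiplication by the
    generators, which avoids writing elements as sums of monomials.\<close>
  define M where "M = {y \<in> carrier R. \<forall>\<alpha>. \<xi> (y \<otimes> monomial T \<alpha>) = \<zero>}"
  \<comment> \<open>Membership of a in M alone would not pass to products; stability of M under
    multiplication by a does.\<close>
  have gen: "a \<in> carrier R \<and> (\<forall>y\<in>M. a \<otimes> y \<in> M)" if "a \<in> subalgebra_gen T" for a
    using that
  proof (induction rule: generate_ring.induct)
    case one
    then show ?case by (auto simp: M_def)
  next
    case (incl h)
    then show ?case
    proof
      assume "h \<in> structure_map R ` carrier k"
      then obtain c where c: "c \<in> carrier k" "h = structure_map R c" by blast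
      then have "h \<otimes> y = c \<odot>\<^bsub>R\<^esub> y" if "y \<in> carrier R" for y
        using that structure_map_mult by simp
      moreover have "h \<in> carrier R" using c structure_map_closed by simp
      ultimately show ?thesis using c(1) mon
        by (auto simp: M_def smult_in smult_mult smult_zero E_smult[OF \<xi>E])
    next
      assume h: "h \<in> T"
      then have hR: "h \<in> carrier R" using T by blast
      have "h \<otimes> y \<in> M" if y: "y \<in> M" for y
      proof -
        have yR: "y \<in> carrier R" using y M_def by simp
        have "\<xi> (h \<otimes> y \<otimes> monomial T \<alpha>) = \<zero>" for \<alpha>
        proof -
          have "h \<otimes> y \<otimes> monomial T \<alpha> = y \<otimes> monomial T (\<alpha>(h := Suc (\<alpha> h)))"
            unfolding monomial_Suc[OF T h] using hR yR mon by (simp add: m_ac)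
          then show ?thesis using y by (simp add: M_def)
        qed
        then show ?thesis using hR yR by (simp add: M_def)
      qed
      then show ?thesis using hR by blast
    qed
  next
    case (a_inv h)
    then show ?case using mon by (auto simp: M_def l_minus E_neg[OF \<xi>E])
  next
    case (eng_add h1 h2)
    then show ?case using mon by (auto simp: M_def l_distr E_add[OF \<xi>E])
  next
    case (eng_mult h1 h2)
    have "h1 \<otimes> h2 \<otimes> y \<in> M" if y: "y \<in> M" for y
    proof -
      have "h1 \<otimes> h2 \<otimes> y = h1 \<otimes> (h2 \<otimes> y)" using eng_mult y by (simp add: M_def m_assoc)
      then show ?thesis using eng_mult y by simp
    qed
    then show ?case using eng_mult by blast
  qed
  have "\<one> \<in> M" using mon mon_van by (simp add: M_def)
  have one: "monomial T (\<lambda>_. 0) = \<one>" by (simp add: monomial_def)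
  have gen_van: "\<xi> a = \<zero>" if a: "a \<in> subalgebra_gen T" for a
  proof -
    have "a \<otimes> \<one> \<in> M" using gen[OF a] \<open>\<one> \<in> M\<close> by blast
    then have "\<xi> (a \<otimes> \<one> \<otimes> monomial T (\<lambda>_. 0)) = \<zero>" unfolding M_def by blast
    then show ?thesis using gen[OF a] one by simp
  qed
  have pow: "s [^] (n::nat) \<in> subalgebra_gen T" if "s \<in> subalgebra_gen T" for s n
    using that by (induction n) (auto intro: generate_ring.one generate_ring.eng_mult)
  show ?thesis
  proof (rule E_eqI[OF \<xi>E])
    fix r assume r: "r \<in> carrier R"
    then obtain a s where as: "a \<in> subalgebra_gen T" "s \<in> subalgebra_gen T" and s: "s \<in> Units R"
      and r_eq: "r = a \<otimes> inv s" using frac by blast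
    obtain m where m: "q = Suc m" using q by (cases q) auto
    have aR: "a \<in> carrier R" and sR: "s \<in> carrier R" "inv s \<in> carrier R" using gen[OF as(1)] s by auto
    \<comment> \<open>This rewrites a/s as s^(q-1) a times the q-th power of 1/s, so that \<xi> acts
      only on an element of the subalgebra.\<close>
    have "inv s [^] q \<otimes> (s [^] m \<otimes> a) = (inv s \<otimes> s) [^] m \<otimes> (a \<otimes> inv s)"
      unfolding nat_pow_distrib[OF sR(2,1)] m using aR sR by (simp add: m_ac)
    also have "\<dots> = r" using s aR r_eq by simp
    finally have "\<xi> r = inv s [^] q \<otimes> \<xi> (s [^] m \<otimes> a)"
      using power_linear_apply[OF \<xi> sR(2), of "s [^] m \<otimes> a"] aR sR by simp
    also have "\<xi> (s [^] m \<otimes> a) = \<zero>"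
      by (intro gen_van generate_ring.eng_mult pow as)
    finally show "\<xi> r = \<zero>\<^bsub>E\<^esub> r" using sR r by simp
  qed simp
qed

section \<open>Integer multiples in k and R, and the reduced case\<close>

lemma add_pow_smult:
  assumes "a \<in> carrier R"
  shows "add_pow k (m::nat) \<one>\<^bsub>k\<^esub> \<odot>\<^bsub>R\<^esub> a = add_pow R m a"
proof -
  interpret A: algebra k R by (rule algebra)
  show ?thesis using assms by (induction m) (auto simp: A.smult_l_distr)
qed

end

text \<open>The split is on whether some positive integer vanishes in R. If so, q = p^n bounds the
  order of \<xi>; otherwise positive integers act invertibly.\<close>

theorem (in anti_automorphism) \<Phi>\<Phi>_reduced:
  assumes k: "field k" and red: "reduced_ring R" and eft: "essentially_of_finite_type TYPE('b) k R"
    and \<xi>: "\<xi> \<in> D"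
  shows "\<Phi> (\<Phi> \<xi>) = \<xi>"
proof -
  obtain T where T: "finite T" "T \<subseteq> carrier R" and frac: "\<And>r. r \<in> carrier R \<Longrightarrow>
      \<exists>a\<in>subalgebra_gen T. \<exists>s\<in>subalgebra_gen T. s \<in> Units R \<and> r = a \<otimes> inv s"
    using essentially_of_finite_type_generators[OF eft] by blast
  obtain n where n: "\<xi> \<in> order_below n" using \<xi> unfolding D_eq by blast
  show ?thesis
  proof (cases "\<exists>p::nat. 0 < p \<and> add_pow R p \<one> = \<zero>")
    case True
    then obtain p :: nat where p: "0 < p" "add_pow R p \<one> = \<zero>" by blast
    have q: "0 < p ^ n" using p by simp
    have "\<xi> \<in> order_below (Suc n)" using n order_below_mono[of n "Suc n"] by simp
    then have "\<xi> \<in> power_linear (p ^ n)"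
      using ad_pow_char[OF p] \<xi> unfolding power_linear_def by blast
    then show ?thesis
      using T monomial_closed power_linear_eq_zero[OF T q frac]
      by (intro \<Phi>\<Phi>_torsion[OF red q, of "monomial T ` (T \<rightarrow>\<^sub>E {..<p ^ n})"]) (auto intro: finite_PiE)
  next
    case False
    interpret k: field k by (rule k)
    interpret A: algebra k R by (rule algebra)
    \<comment> \<open>An integer that is nonzero in R is nonzero in the field k, hence acts on R as
      a unit.\<close>
    have "a = \<zero>" if m: "0 < m" and a: "a \<in> carrier R" "add_pow R (m::nat) a = \<zero>" for m a
    proof -
      let ?u = "add_pow k m \<one>\<^bsub>k\<^esub>"
      have "?u \<noteq> \<zero>\<^bsub>k\<^esub>"
      proof
        assume "?u = \<zero>\<^bsub>k\<^esub>"
        then have "add_pow R m \<one> = \<zero>" using add_pow_smult[OF one_closed, of m] by simp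
        then show False using False m by blast
      qed
      then have u: "?u \<in> Units k" using k.field_Units by simp
      then have "(inv\<^bsub>k\<^esub> ?u \<otimes>\<^bsub>k\<^esub> ?u) \<odot>\<^bsub>R\<^esub> a = inv\<^bsub>k\<^esub> ?u \<odot>\<^bsub>R\<^esub> (?u \<odot>\<^bsub>R\<^esub> a)"
        using a by (intro A.smult_assoc1) auto
      then show ?thesis using a u by (simp add: add_pow_smult smult_zero)
    qed
    moreover have "\<xi> \<in> order_below (Suc (Suc n))" using n order_below_mono[of n "Suc (Suc n)"] by simp
    ultimately show ?thesis
      using \<Phi>\<Phi>_char_0[OF red _ T derivation_eq_zero[OF T(2) frac]] by blast
  qed
qed

section \<open>Adjoints with respect to a symmetric form\<close>

text \<open>Symmetry of the form \<sigma>(f g) makes the adjoint of the adjoint the original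
  operator. Surjectivity of \<phi> provides the adjoints, and injectivity of \<phi> is the
  nondegeneracy that makes them unique.\<close>

theorem (in anti_automorphism) \<Phi>\<Phi>_dual:
  assumes \<phi>: "\<phi> \<in> linear_isos R (self_module R) (dual_module k R)"
    and act: "corresponds_to_action k R \<Phi> (pullback_action R \<phi>)"
    and \<xi>: "\<xi> \<in> D"
  shows "\<Phi> (\<Phi> \<xi>) = \<xi>"
proof -
  define \<sigma> where "\<sigma> = \<phi> \<one>"
  have bij: "bij_betw \<phi> (carrier R) (linear_maps k R (self_module k))"
    using \<phi> by (simp add: linear_isos_def self_module_def dual_module_def)
  have \<phi>_apply: "\<phi> f g = \<sigma> (f \<otimes> g)" if "f \<in> carrier R" "g \<in> carrier R" for f g
  proof -
    have "\<forall>c\<in>carrier R. \<forall>x\<in>carrier R. \<phi> (c \<otimes> x) = (\<lambda>g\<in>carrier R. \<phi> x (c \<otimes> g))"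
      using \<phi> unfolding linear_isos_def linear_maps_def
      by (simp add: self_module_def dual_module_def)
    \<comment> \<open>By R-linearity at 1, every functional \<phi>(f) is f acting on the single
      functional \<sigma>.\<close>
    then have "\<phi> (f \<otimes> \<one>) = (\<lambda>g\<in>carrier R. \<phi> \<one> (f \<otimes> g))" using that(1) one_closed by blast
    then show ?thesis using that by (simp add: \<sigma>_def)
  qed
  have \<phi>_ext: "\<phi> f \<in> extensional (carrier R)" if "f \<in> carrier R" for f
  proof -
    have "\<phi> f \<in> linear_maps k R (self_module k)" using bij that unfolding bij_betw_def by blast
    then show ?thesis unfolding linear_maps_def by (simp add: PiE_iff)
  qed
  have adj: "\<sigma> (\<Phi> \<eta> f \<otimes> g) = \<sigma> (f \<otimes> \<eta> g)" if \<eta>: "\<eta> \<in> D" and f: "f \<in> carrier R" and g: "g \<in> carrier R" for \<eta> f g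
  proof -
    have \<eta>E: "\<eta> \<in> carrier E" using \<eta> by blast
    have "\<phi> f \<in> linear_maps k R (self_module k)" using bij f unfolding bij_betw_def by blast
    \<comment> \<open>The composite is again a k-linear functional, so it lies in the image of
      \<phi> and \<open>inv_into\<close> yields a genuine preimage.\<close>
    then have "compose (carrier R) (\<phi> f) \<eta> \<in> linear_maps k R (self_module k)"
      using E_closed[OF \<eta>E] unfolding linear_maps_def
      by (auto simp: compose_def E_add[OF \<eta>E] E_smult[OF \<eta>E] smult_in self_module_def)
    then have "\<phi> (\<Phi> \<eta> f) = compose (carrier R) (\<phi> f) \<eta>"
      using act \<eta> f bij unfolding corresponds_to_action_def pullback_action_def dual_action_def bij_betw_def
      by (simp add: f_inv_into_f)
    then have "\<phi> (\<Phi> \<eta> f) g = \<phi> f (\<eta> g)" using g by (simp add: compose_def)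
    then show ?thesis using \<phi>_apply f g E_closed[OF \<eta>E] E_closed[OF D_E[OF \<Phi>_D[OF \<eta>]]] by simp
  qed
  have cl: "\<xi> f \<in> carrier R" "\<Phi> \<xi> f \<in> carrier R" "\<Phi> (\<Phi> \<xi>) f \<in> carrier R" if "f \<in> carrier R" for f
    using \<xi> that E_closed[OF D_E] by auto
  show ?thesis
  proof (rule E_eqI)
    fix f assume f: "f \<in> carrier R"
    have "\<phi> (\<Phi> (\<Phi> \<xi>) f) g = \<phi> (\<xi> f) g" if g: "g \<in> carrier R" for g
    proof -
      \<comment> \<open>Each adjunction is followed by a swap of the two factors; this is where
        commutativity of R gives symmetry of the form.\<close>
      have "\<sigma> (\<Phi> (\<Phi> \<xi>) f \<otimes> g) = \<sigma> (\<Phi> \<xi> g \<otimes> f)" using adj[OF \<Phi>_D[OF \<xi>] f g] f g cl by (simp add: m_comm)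
      also have "\<dots> = \<sigma> (\<xi> f \<otimes> g)" using adj[OF \<xi> g f] f g cl by (simp add: m_comm)
      finally show ?thesis using \<phi>_apply cl f g by simp
    qed
    then have "\<phi> (\<Phi> (\<Phi> \<xi>) f) = \<phi> (\<xi> f)"
      by (rule extensionalityI[OF \<phi>_ext[OF cl(3)[OF f]] \<phi>_ext[OF cl(1)[OF f]]])
    then show "\<Phi> (\<Phi> \<xi>) f = \<xi> f" using bij cl[OF f] unfolding bij_betw_def inj_on_def by blast
  qed (use \<xi> in auto)
qed

theorem theorem4p8:
  fixes k :: "('k, 'x) ring_scheme"
    and R :: "('k, 'a, 'y) module_scheme"
    and \<Phi> :: "('a \<Rightarrow> 'a) \<Rightarrow> ('a \<Rightarrow> 'a)"
  assumes "field k"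
    and "algebra k R"
    and "ring_anti_automorphism (diff_ops_ring k R) \<Phi>"
    and "\<forall>f\<in>carrier R. \<Phi> (mult_op R f) = mult_op R f"
    and "(reduced_ring R \<and> essentially_of_finite_type TYPE('b) k R) \<or>
         (local_ring R \<and> gorenstein_local_ring TYPE('e) R \<and> krull_dim R = 0 \<and>
          coefficient_field (structure_map R ` carrier k) R \<and>
          (\<exists>\<phi>\<in>linear_isos R (self_module R) (dual_module k R).
             corresponds_to_action k R \<Phi> (pullback_action R \<phi>)))"
  shows "\<forall>\<xi>\<in>carrier (diff_ops_ring k R). \<Phi> (\<Phi> \<xi>) = \<xi>"
proof -
  interpret anti_automorphism k R \<Phi>
  proof (intro anti_automorphism.intro algebra_operators.intro
      algebra_operators_axioms.intro anti_automorphism_axioms.intro)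
    show "cring R" using assms(2) by (rule algebra.M_cring)
  qed (use assms in blast)+
  from assms(5) show ?thesis
  proof
    assume "reduced_ring R \<and> essentially_of_finite_type TYPE('b) k R"
    then show ?thesis using \<Phi>\<Phi>_reduced[OF assms(1)] by blast
  next
    assume "local_ring R \<and> gorenstein_local_ring TYPE('e) R \<and> krull_dim R = 0 \<and>
      coefficient_field (structure_map R ` carrier k) R \<and>
      (\<exists>\<phi>\<in>linear_isos R (self_module R) (dual_module k R).
         corresponds_to_action k R \<Phi> (pullback_action R \<phi>))"
    then obtain \<phi> where "\<phi> \<in> linear_isos R (self_module R) (dual_module k R)"
      "corresponds_to_action k R \<Phi> (pullback_action R \<phi>)" by blast
    then show ?thesis using \<Phi>\<Phi>_dual by blast
  qed
qed

end
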